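(* Let $G=(V,E,w)$ be an $n$-vertex $\beta$-balanced directed graph with edge weights in $[1, \mathrm{poly}(n)]$, and let $0<\epsilon<1$. There exists a $(1\pm\epsilon)$ for-each cut sketch of $G$ of size $O(n \beta^{1/2} \log^{3} n / \epsilon)$ bits that approximates the value $w(S, V \setminus S)$ of every directed cut $S \subseteq V$ with high probability.
   Context: For $S,T\subseteq V$, $w(S,T)$ is the total weight of edges from $S$ to $T$; $\overline S=V\setminus S$. $G$ is $\beta$-balanced (for $\beta\ge1$) if it is strongly connected and $w(S,\overline S)\le\beta\,w(\overline S,S)$ for all $\varnothing\ne S\subsetneq V$. A (randomized) function $g$ outputs a $(1\pm\epsilon)$ for-each cut sketch of $G$ if there is a recovering function $f$ such that for each fixed $S\subseteq V$, with probability at least $2/3$ (here: with high probability), $(1-\epsilon)w(S,\overline S)\le f(S,g(G))\le(1+\epsilon)w(S,\overline S)$. *)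

theory Defs
  imports "HOL-Probability.Probability"
begin

text \<open>A weighted directed graph on the vertex set V = {..<n} is a weight function
  w :: nat => nat => real; w i j > 0 means there is an edge i -> j of weight w i j,
  and w i j = 0 means there is no edge.\<close>

definition cutw :: "(nat \<Rightarrow> nat \<Rightarrow> real) \<Rightarrow> nat set \<Rightarrow> nat set \<Rightarrow> real" where
  "cutw w S T = (\<Sum>i\<in>S. \<Sum>j\<in>T. w i j)"

definition edge_rel :: "nat \<Rightarrow> (nat \<Rightarrow> nat \<Rightarrow> real) \<Rightarrow> (nat \<times> nat) set" where
  "edge_rel n w = {(i, j). i < n \<and> j < n \<and> w i j > 0}"

definition strongly_connected :: "nat \<Rightarrow> (nat \<Rightarrow> nat \<Rightarrow> real) \<Rightarrow> bool" where
  "strongly_connected n w \<longleftrightarrow> (\<forall>i<n. \<forall>j<n. (i, j) \<in> (edge_rel n w)\<^sup>*)"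

definition balanced :: "nat \<Rightarrow> real \<Rightarrow> (nat \<Rightarrow> nat \<Rightarrow> real) \<Rightarrow> bool" where
  "balanced n \<beta> w \<longleftrightarrow> \<beta> \<ge> 1 \<and> strongly_connected n w \<and>
     (\<forall>S. S \<noteq> {} \<and> S \<subset> {..<n} \<longrightarrow>
        cutw w S ({..<n} - S) \<le> \<beta> * cutw w ({..<n} - S) S)"

text \<open>Edge weights lie in [1, n^k], and there are no edges outside V.\<close>
definition weights_ok :: "nat \<Rightarrow> nat \<Rightarrow> (nat \<Rightarrow> nat \<Rightarrow> real) \<Rightarrow> bool" where
  "weights_ok n k w \<longleftrightarrow>
     (\<forall>i j. w i j \<noteq> 0 \<longrightarrow> i < n \<and> j < n \<and> 1 \<le> w i j \<and> w i j \<le> real n ^ k)"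

end

theory Submission
  imports Defs
begin

text \<open>
  Round the weights to integer multiples of \<open>\<epsilon> / 4\<close>. For \<open>i = 0, 1, ...\<close> and \<open>\<lambda> = 2 ^ i / n\<close>, partition
  the vertices so that inside every class \<open>C\<close> the undirected cut between \<open>C \<inter> S\<close> and \<open>C - S\<close> weighs at
  least \<open>\<lambda>\<close> times the size of its smaller side. Each partition minimises (crossing weight) + \<open>\<lambda>\<close> (potential)
  among the refinements of the previous one, where the potential is the sum of \<open>log 2 (size of the class
  of v)\<close> over all vertices \<open>v\<close>; minimality gives the cut property, and the weight newly cut at each level is
  paid for by the drop of the potential, so that the sum over edges of weight / \<open>\<lambda>\<close>(level) is \<open>O(n log n)\<close>.

  With \<open>R\<close> of order \<open>sqrt \<beta> log n / \<epsilon>\<close>, edges heavier than \<open>\<lambda> / R\<close> at their level are stored, and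
  there are only \<open>O(R n log n)\<close> of them. For the light edges the sketch stores the in- and out-degrees at
  each level, and samples about \<open>R\<close> edges per vertex and level with probability proportional to the weight.
  To estimate the light cut edges of level \<open>i\<close> inside a class \<open>C\<close>, take the smaller side, say
  \<open>C \<inter> S\<close>. A vertex \<open>u\<close> there sends light weight at most \<open>|C \<inter> S| \<lambda> / R \<le> U / R\<close> into \<open>S\<close>, \<open>U\<close> being the
  undirected value of the cut. If the degree \<open>d\<close> of \<open>u\<close> is at most twice this bound, use the sampled edges leaving
  \<open>S\<close>; the variance is at most \<open>d / R \<le> 2 U / R\<^sup>2\<close> times the true value. Otherwise use \<open>d\<close> minus the sampled
  edges staying in \<open>S\<close>; at least half of \<open>d\<close> then leaves \<open>S\<close>, and the variance \<open>(U / R) d / R\<close> obeys the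
  same bound up to a constant. With \<open>D\<close> the directed cut value, the total variance is
  \<open>O(U D / R\<^sup>2) = O(\<beta> D\<^sup>2 / R\<^sup>2) = O((\<epsilon> D / log n)\<^sup>2)\<close>, and a Bernstein bound applies.
\<close>

subsection \<open>Counting and encoding\<close>

text \<open>Induction on \<open>M\<close>: a function with at most \<open>M + 1\<close> nonzero
  entries comes from one with at most \<open>M\<close> by overwriting at most one entry. The option
  \<open>None\<close> and the pairs of a position and a value in \<open>1..Q\<close> give the base
  \<open>card X * Q + 1\<close>.\<close>

lemma card_sparse_functions_le:
  fixes X :: "'a set" and Q :: nat
  assumes "finite X"
  defines "G \<equiv> \<lambda>M. {F :: 'a \<Rightarrow> nat. {x. F x \<noteq> 0} \<subseteq> X \<and> card {x. F x \<noteq> 0} \<le> M \<and> (\<forall>x. F x \<le> Q)}"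
  shows "finite (G M) \<and> card (G M) \<le> (card X * Q + 1) ^ M"
proof (induction M)
  case 0
  have "F = (\<lambda>_. 0)" if "F \<in> G 0" for F
  proof -
    have "finite {x. F x \<noteq> 0}" using that assms(1) finite_subset unfolding G_def by auto
    then show ?thesis using that unfolding G_def by auto
  qed
  then have "G 0 \<subseteq> {\<lambda>_. 0}" by blast
  then show ?case using card_mono[of "{\<lambda>_. 0}" "G 0"] finite_subset by fastforce
next
  case (Suc M)
  let ?Y = "insert None (Some ` (X \<times> {1..Q}))"
  let ?upd = "\<lambda>(F :: 'a \<Rightarrow> nat, y). case y of None \<Rightarrow> F | Some (x, q) \<Rightarrow> F(x := q)"
  have sub: "G (Suc M) \<subseteq> ?upd ` (G M \<times> ?Y)"
  proof
    fix F assume F: "F \<in> G (Suc M)"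
    show "F \<in> ?upd ` (G M \<times> ?Y)"
    proof (cases "F \<in> G M")
      case True
      then show ?thesis by (intro image_eqI[of _ _ "(F, None)"]) auto
    next
      case False
      have fin: "finite {x. F x \<noteq> 0}" using F assms(1) finite_subset unfolding G_def by auto
      with False F have "{x. F x \<noteq> 0} \<noteq> {}" unfolding G_def by fastforce
      then obtain x where x: "F x \<noteq> 0" by blast
      have "{y. (F(x := 0)) y \<noteq> 0} = {y. F y \<noteq> 0} - {x}" by auto
      then have "F(x := 0) \<in> G M" using F fin x unfolding G_def by auto
      moreover have "Some (x, F x) \<in> ?Y" using F x unfolding G_def by (auto simp: Suc_le_eq)
      ultimately show ?thesis by (intro image_eqI[of _ _ "(F(x := 0), Some (x, F x))"]) auto
    qed
  qed
  have fin: "finite (G M \<times> ?Y)" using Suc assms(1) by auto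
  have 1: "finite (G (Suc M))" "card (G (Suc M)) \<le> card (G M \<times> ?Y)"
    using finite_subset[OF sub finite_imageI[OF fin]]
      order_trans[OF card_mono[OF finite_imageI[OF fin] sub] card_image_le[OF fin]] by auto
  have "card ?Y = card X * Q + 1"
    using assms(1) by (subst card_insert_disjoint) (auto simp: card_image card_cartesian_product)
  then have "card (G M \<times> ?Y) = card (G M) * (card X * Q + 1)" by (simp only: card_cartesian_product)
  also have "\<dots> \<le> (card X * Q + 1) ^ M * (card X * Q + 1)" using Suc by (intro mult_right_mono) auto
  finally show ?case using 1 by (simp add: mult.commute)
qed

lemma ex_fixed_length_encoding:
  assumes "finite X" "card X \<le> 2 ^ B"
  obtains enc :: "'a \<Rightarrow> bool list" where "inj_on enc X" "\<And>x. x \<in> X \<Longrightarrow> length (enc x) = B"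
proof -
  let ?L = "{xs :: bool list. set xs \<subseteq> UNIV \<and> length xs = B}"
  have "card ?L = 2 ^ B" by (subst card_lists_length_eq) auto
  moreover have "finite ?L" by (rule finite_lists_length_eq) simp
  ultimately obtain enc where "enc ` X \<subseteq> ?L" "inj_on enc X"
    using card_le_inj[of X ?L] assms by auto
  then show ?thesis using that by blast
qed

subsection \<open>Concentration of independent samples\<close>

text \<open>For negative arguments put y = -x: then (1 - y + y^2)(1 + y + y^2/2) = 1 + (y^2 + y^3 +
  y^4)/2 is at least 1, and the second factor is at most exp y.\<close>

lemma exp_le_quadratic:
  fixes x :: real
  assumes "\<bar>x\<bar> \<le> 1"
  shows "exp x \<le> 1 + x + x\<^sup>2"
proof (cases "x \<ge> 0")
  case True
  then show ?thesis using exp_bound assms by auto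
next
  case False
  define y where "y = - x"
  have y: "y \<ge> 0" using False y_def by simp
  have q: "1 + y + y\<^sup>2 / 2 \<le> exp y" using exp_lower_Taylor_quadratic y by blast
  have p: "1 - y + y\<^sup>2 \<ge> 0"
    using zero_le_power2[of "y - 1"] zero_le_power2[of y] y by (simp add: power2_eq_square algebra_simps)
  have "(1 - y + y\<^sup>2) * (1 + y + y\<^sup>2 / 2) = 1 + (y^2 + y^3 + y^4) / 2"
    by (simp add: power2_eq_square power3_eq_cube power4_eq_xxxx field_simps)
  then have "1 \<le> (1 - y + y\<^sup>2) * (1 + y + y\<^sup>2 / 2)" using y by simp
  also have "\<dots> \<le> (1 - y + y\<^sup>2) * exp y" using p q by (intro mult_left_mono) auto
  finally have "exp (- y) \<le> 1 - y + y\<^sup>2" by (simp add: exp_minus field_simps)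
  then show ?thesis by (simp add: y_def)
qed

lemma measure_pmf_Chernoff:
  fixes f :: "'a \<Rightarrow> real"
  assumes "finite (set_pmf p)"
  shows "measure_pmf.prob p {x. f x \<ge> a} \<le> exp (- a) * measure_pmf.expectation p (\<lambda>x. exp (f x))"
proof -
  have "measure_pmf.prob p {x \<in> UNIV. f x \<ge> a} \<le>
      exp (- 1 * a) * (LINT x:UNIV|measure_pmf p. exp (1 * f x))"
    by (intro measure_pmf.Chernoff_ineq_ge)
       (auto simp: set_integrable_def intro!: integrable_measure_pmf_finite assms)
  then show ?thesis by (simp add: set_lebesgue_integral_def)
qed

lemma finite_set_Pi_pmf_bool:
  "finite E \<Longrightarrow> finite (set_pmf (Pi_pmf E False (p :: 'a \<Rightarrow> bool pmf)))"
  by (simp add: set_Pi_pmf finite_PiE_dflt)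

lemma expectation_exp_sum_Pi_bernoulli:
  fixes h :: "'a \<Rightarrow> bool \<Rightarrow> real"
  assumes "finite E" "\<And>e. e \<in> E \<Longrightarrow> 0 \<le> p e \<and> p e \<le> 1"
  shows "measure_pmf.expectation (Pi_pmf E False (\<lambda>e. bernoulli_pmf (p e)))
      (\<lambda>y. exp (\<Sum>e\<in>E. h e (y e)))
    = (\<Prod>e\<in>E. exp (h e True) * p e + exp (h e False) * (1 - p e))"
proof -
  have "measure_pmf.expectation (Pi_pmf E False (\<lambda>e. bernoulli_pmf (p e)))
      (\<lambda>y. exp (\<Sum>e\<in>E. h e (y e)))
    = measure_pmf.expectation (Pi_pmf E False (\<lambda>e. bernoulli_pmf (p e)))
      (\<lambda>y. \<Prod>e\<in>E. exp (h e (y e)))"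
    by (simp add: exp_sum assms(1))
  also have "\<dots> = (\<Prod>e\<in>E. measure_pmf.expectation (bernoulli_pmf (p e)) (\<lambda>b. exp (h e b)))"
    by (rule expectation_prod_Pi_pmf) (auto simp: assms intro!: integrable_measure_pmf_finite)
  also have "\<dots> = (\<Prod>e\<in>E. exp (h e True) * p e + exp (h e False) * (1 - p e))"
    using assms(2) by (intro prod.cong) auto
  finally show ?thesis .
qed

text \<open>Chernoff bound with parameter 1: each factor of the moment generating function is 1 + (e
  - 1) p \<le> 1 + 2 p \<le> exp (2 p), so the tail is at most exp (2 \<mu> - 3 \<mu>). It later
  limits how many edges are sampled.\<close>

lemma prob_many_successes_le:
  assumes "finite E" "\<And>e. e \<in> E \<Longrightarrow> 0 \<le> p e \<and> p e \<le> 1" "(\<Sum>e\<in>E. p e) \<le> \<mu>"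
  shows "measure_pmf.prob (Pi_pmf E False (\<lambda>e. bernoulli_pmf (p e)))
      {y. real (card {e \<in> E. y e}) \<ge> 3 * \<mu>} \<le> exp (- \<mu>)"
proof -
  let ?P = "Pi_pmf E False (\<lambda>e. bernoulli_pmf (p e))"
  have card: "real (card {e \<in> E. y e}) = (\<Sum>e\<in>E. of_bool (y e))" for y
    using assms(1) by (simp add: Int_def)
  have "measure_pmf.prob ?P {y. real (card {e \<in> E. y e}) \<ge> 3 * \<mu>}
      \<le> exp (- (3 * \<mu>)) * measure_pmf.expectation ?P (\<lambda>y. exp (real (card {e \<in> E. y e})))"
    by (intro measure_pmf_Chernoff finite_set_Pi_pmf_bool assms)
  also have "measure_pmf.expectation ?P (\<lambda>y. exp (real (card {e \<in> E. y e})))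
      = (\<Prod>e\<in>E. exp 1 * p e + exp 0 * (1 - p e))"
    unfolding card using expectation_exp_sum_Pi_bernoulli[OF assms(1,2), where h = "\<lambda>_ b. of_bool b"] by simp
  also have "\<dots> \<le> (\<Prod>e\<in>E. exp (2 * p e))"
  proof (intro prod_mono)
    fix e assume "e \<in> E"
    then have p: "0 \<le> p e" "p e \<le> 1" using assms(2) by auto
    have "exp 1 * p e + exp 0 * (1 - p e) \<le> 3 * p e + (1 - p e)"
      using exp_le p by (simp add: mult_right_mono)
    also have "\<dots> \<le> exp (2 * p e)" using exp_ge_add_one_self[of "2 * p e"] by linarith
    finally show "0 \<le> exp 1 * p e + exp 0 * (1 - p e) \<and> exp 1 * p e + exp 0 * (1 - p e) \<le> exp (2 * p e)"
      using p by simp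
  qed
  also have "\<dots> = exp (2 * (\<Sum>e\<in>E. p e))" by (simp add: exp_sum assms(1) sum_distrib_left)
  also have "exp (- (3 * \<mu>)) * \<dots> \<le> exp (- (3 * \<mu>)) * exp (2 * \<mu>)" using assms(3) by simp
  also have "\<dots> = exp (- \<mu>)" by (simp flip: exp_add)
  finally show ?thesis by simp
qed

text \<open>A Bernstein bound. Element \<open>e\<close> survives with probability
  \<open>a e / z e\<close> and then counts \<open>z e\<close>, so each summand is centred with
  second moment at most \<open>a e * z e\<close>. The exponential moment is taken at
  \<open>1 / b\<close>, where noisy summands have absolute value at most 1. Elements with
  \<open>z e = a e\<close> are always kept and add no noise, so \<open>b\<close> and
  \<open>V\<close> ignore them.\<close>

lemma importance_sampling_upper_tail:
  fixes a z \<sigma> :: "'a \<Rightarrow> real"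
  assumes "finite E" and az: "\<And>e. e \<in> E \<Longrightarrow> 0 < a e \<and> a e \<le> z e"
    and "b > 0" and \<sigma>: "\<And>e. e \<in> E \<Longrightarrow> \<bar>\<sigma> e\<bar> \<le> 1"
    and zb: "\<And>e. e \<in> E \<Longrightarrow> \<sigma> e \<noteq> 0 \<Longrightarrow> z e \<noteq> a e \<Longrightarrow> z e \<le> b"
    and V: "(\<Sum>e | e \<in> E \<and> \<sigma> e \<noteq> 0 \<and> z e \<noteq> a e. a e * z e) \<le> V"
  shows "measure_pmf.prob (Pi_pmf E False (\<lambda>e. bernoulli_pmf (a e / z e)))
      {y. (\<Sum>e\<in>E. \<sigma> e * (z e * of_bool (y e) - a e)) \<ge> x} \<le> exp (V / b\<^sup>2 - x / b)"
proof -
  let ?P = "Pi_pmf E False (\<lambda>e. bernoulli_pmf (a e / z e))"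
  let ?h = "\<lambda>e t. \<sigma> e * (z e * of_bool t - a e) / b"
  let ?v = "\<lambda>e. if \<sigma> e \<noteq> 0 \<and> z e \<noteq> a e then a e * z e / b\<^sup>2 else 0"
  have p: "0 \<le> a e / z e \<and> a e / z e \<le> 1" if "e \<in> E" for e using az[OF that] by auto
  have factor: "exp (?h e True) * (a e / z e) + exp (?h e False) * (1 - a e / z e) \<le> exp (?v e)"
    if "e \<in> E" for e
  proof -
    consider "\<sigma> e = 0" | "z e = a e" | "\<sigma> e \<noteq> 0" "z e \<noteq> a e" by blast
    then show ?thesis
    proof cases
      case 3
      have z: "z e \<le> b" "0 < a e" "a e \<le> z e" "0 < z e" and s: "\<bar>\<sigma> e\<bar> \<le> 1"
        using zb[OF that 3] az[OF that] \<sigma>[OF that] by auto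
      have le1: "\<bar>?h e t\<bar> \<le> 1" for t
      proof -
        have "\<bar>z e * of_bool t - a e\<bar> \<le> b" using z by (cases t) auto
        then have "\<bar>\<sigma> e\<bar> * \<bar>z e * of_bool t - a e\<bar> \<le> 1 * b" using s by (intro mult_mono) auto
        then show ?thesis using assms(3) by (simp only: abs_mult abs_divide) simp
      qed
      define q where "q = a e / z e"
      have q: "0 \<le> q" "q \<le> 1" "z e * q = a e" using p[OF that] z unfolding q_def by auto
      have s2: "(\<sigma> e)\<^sup>2 \<le> 1" using s by (simp add: abs_square_le_1)
      have "exp (?h e True) * q + exp (?h e False) * (1 - q)
          \<le> (1 + ?h e True + (?h e True)\<^sup>2) * q + (1 + ?h e False + (?h e False)\<^sup>2) * (1 - q)"
        using q by (intro add_mono mult_right_mono exp_le_quadratic le1) auto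
      also have "\<dots> = 1 + \<sigma> e * (z e * q - a e) / b
          + (\<sigma> e)\<^sup>2 * ((z e * q) * z e - 2 * (z e * q) * a e + (a e)\<^sup>2) / b\<^sup>2"
        using assms(3) by (simp add: field_simps power2_eq_square)
      \<comment> \<open>Substituting \<open>z e * q = a e\<close> kills the linear term and turns
        the quadratic one into the variance.\<close>
      also have "\<dots> = 1 + (\<sigma> e)\<^sup>2 * (a e * z e - (a e)\<^sup>2) / b\<^sup>2"
        unfolding q by (simp add: power2_eq_square)
      also have "\<dots> \<le> 1 + 1 * (a e * z e) / b\<^sup>2"
        using s2 z by (intro add_left_mono divide_right_mono mult_mono) (auto simp: power2_eq_square)
      also have "\<dots> \<le> exp (?v e)" using 3 exp_ge_add_one_self by simp
      finally show ?thesis unfolding q_def .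
    qed (use az[OF that] in auto)
  qed
  have "measure_pmf.prob ?P {y. (\<Sum>e\<in>E. \<sigma> e * (z e * of_bool (y e) - a e)) \<ge> x}
      = measure_pmf.prob ?P {y. (\<Sum>e\<in>E. ?h e (y e)) \<ge> x / b}"
    using assms(3) by (simp add: divide_le_cancel flip: sum_divide_distrib)
  also have "\<dots> \<le> exp (- (x / b)) * measure_pmf.expectation ?P (\<lambda>y. exp (\<Sum>e\<in>E. ?h e (y e)))"
    by (intro measure_pmf_Chernoff finite_set_Pi_pmf_bool assms)
  also have "measure_pmf.expectation ?P (\<lambda>y. exp (\<Sum>e\<in>E. ?h e (y e)))
     = (\<Prod>e\<in>E. exp (?h e True) * (a e / z e) + exp (?h e False) * (1 - a e / z e))"
    by (rule expectation_exp_sum_Pi_bernoulli[OF assms(1) p])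
  also have "\<dots> \<le> (\<Prod>e\<in>E. exp (?v e))"
    by (intro prod_mono conjI factor add_nonneg_nonneg mult_nonneg_nonneg) (use p in auto)
  also have "\<dots> = exp ((\<Sum>e | e \<in> E \<and> \<sigma> e \<noteq> 0 \<and> z e \<noteq> a e. a e * z e) / b\<^sup>2)"
    using assms(1) by (simp add: sum.If_cases sum_divide_distrib Int_def flip: exp_sum)
  also have "\<dots> \<le> exp (V / b\<^sup>2)" using V by (simp add: divide_right_mono)
  finally show ?thesis by (simp add: exp_diff exp_minus field_simps)
qed

lemma importance_sampling_tail:
  fixes a z \<sigma> :: "'a \<Rightarrow> real"
  assumes "finite E" "\<And>e. e \<in> E \<Longrightarrow> 0 < a e \<and> a e \<le> z e"
    and "b > 0" "\<And>e. e \<in> E \<Longrightarrow> \<bar>\<sigma> e\<bar> \<le> 1"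
    and "\<And>e. e \<in> E \<Longrightarrow> \<sigma> e \<noteq> 0 \<Longrightarrow> z e \<noteq> a e \<Longrightarrow> z e \<le> b"
    and "(\<Sum>e | e \<in> E \<and> \<sigma> e \<noteq> 0 \<and> z e \<noteq> a e. a e * z e) \<le> V"
  shows "measure_pmf.prob (Pi_pmf E False (\<lambda>e. bernoulli_pmf (a e / z e)))
      {y. \<bar>\<Sum>e\<in>E. \<sigma> e * (z e * of_bool (y e) - a e)\<bar> \<ge> x} \<le> 2 * exp (V / b\<^sup>2 - x / b)"
    (is "measure_pmf.prob ?P ?B \<le> _")
proof -
  let ?B' = "\<lambda>\<tau>. {y. (\<Sum>e\<in>E. \<tau> e * (z e * of_bool (y e) - a e)) \<ge> x}"
  have "?B \<subseteq> ?B' \<sigma> \<union> ?B' (\<lambda>e. - \<sigma> e)" by (auto simp: sum_negf abs_if split: if_splits)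
  then have "measure_pmf.prob ?P ?B \<le> measure_pmf.prob ?P (?B' \<sigma> \<union> ?B' (\<lambda>e. - \<sigma> e))"
    by (intro measure_pmf.finite_measure_mono) auto
  also have "\<dots> \<le> measure_pmf.prob ?P (?B' \<sigma>) + measure_pmf.prob ?P (?B' (\<lambda>e. - \<sigma> e))"
    by (rule measure_Un_le) auto
  also have "\<dots> \<le> exp (V / b\<^sup>2 - x / b) + exp (V / b\<^sup>2 - x / b)"
    using assms by (intro add_mono importance_sampling_upper_tail) auto
  finally show ?thesis by simp
qed

subsection \<open>Hierarchies of sparse partitions\<close>

definition class_of :: "nat \<Rightarrow> (nat \<Rightarrow> nat) \<Rightarrow> nat \<Rightarrow> nat set" where
  "class_of n c v = {u. u < n \<and> c u = c v}"

text \<open>\<open>potential n c / n\<close> is the conditional entropy, in bits, of a uniformly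
  random vertex given its class.\<close>

definition potential :: "nat \<Rightarrow> (nat \<Rightarrow> nat) \<Rightarrow> real" where
  "potential n c = (\<Sum>v<n. log 2 (real (card (class_of n c v))))"

definition cross_weight :: "nat \<Rightarrow> (nat \<Rightarrow> nat \<Rightarrow> nat) \<Rightarrow> (nat \<Rightarrow> nat) \<Rightarrow> real" where
  "cross_weight n a c = (\<Sum>u<n. \<Sum>v<n. if c u \<noteq> c v then real (a u v) else 0)"

definition ucut :: "nat \<Rightarrow> (nat \<Rightarrow> nat \<Rightarrow> nat) \<Rightarrow> nat set \<Rightarrow> nat set \<Rightarrow> real" where
  "ucut n a A B = (\<Sum>u<n. \<Sum>v<n.
     if u \<in> A \<and> v \<in> B \<or> u \<in> B \<and> v \<in> A then real (a u v) else 0)"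

lemma finite_class_of [simp]: "finite (class_of n c v)"
  by (simp add: class_of_def)

lemma potential_nonneg: "0 \<le> potential n c"
  unfolding potential_def
proof (intro sum_nonneg)
  fix v assume "v \<in> {..<n}"
  then have "class_of n c v \<noteq> {}" by (auto simp: class_of_def)
  then have "1 \<le> card (class_of n c v)" by (simp add: Suc_le_eq card_gt_0_iff)
  then show "0 \<le> log 2 (real (card (class_of n c v)))" by simp
qed

lemma ucut_mono:
  assumes "A \<subseteq> A'" "B \<subseteq> B'"
  shows "ucut n a A B \<le> ucut n a A' B'"
  unfolding ucut_def using assms by (intro sum_mono) auto

text \<open>Splitting a class lowers the potential by at least the size of the smaller part, because each
  vertex of that part sees its class shrink by a factor of at least two.\<close>
lemma split_class:
  fixes c :: "nat \<Rightarrow> nat"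
  assumes "l \<notin> c ` {..<n}" and C: "C = class_of n c w"
    and A: "A = C \<inter> S" and B: "B = C - S" and "A \<noteq> {}" "B \<noteq> {}"
  defines "c' \<equiv> \<lambda>u. if u \<in> A then l else c u"
  shows "cross_weight n a c' = cross_weight n a c + ucut n a A B"
    and "potential n c' + real (min (card A) (card B)) \<le> potential n c"
proof -
  have l: "c u \<noteq> l" if "u < n" for u using that assms(1) by auto
  \<comment> \<open>Because the colour \<open>l\<close> is fresh, the pairs separated by
    \<open>c'\<close> but not by \<open>c\<close> are exactly those joining \<open>A\<close> and
    \<open>B\<close>.\<close>
  have pointwise: "(if c' u \<noteq> c' v then real (a u v) else 0) = (if c u \<noteq> c v then real (a u v) else 0)
      + (if u \<in> A \<and> v \<in> B \<or> u \<in> B \<and> v \<in> A then real (a u v) else 0)" if "u < n" "v < n" for u v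
    using that l[of u] l[of v] unfolding c'_def A B C class_of_def by auto
  then show "cross_weight n a c' = cross_weight n a c + ucut n a A B"
    unfolding cross_weight_def ucut_def sum.distrib[symmetric]
    by (intro sum.cong refl pointwise) auto
  define g where "g = (\<lambda>v. log 2 (real (card (class_of n c v))) - log 2 (real (card (class_of n c' v))))"
  have pos: "0 < card (class_of n d v)" if "v < n" for d v
    using that by (auto simp: class_of_def card_gt_0_iff)
  have g_nonneg: "0 \<le> g v" if "v < n" for v
  proof -
    have "class_of n c' v \<subseteq> class_of n c v"
      using that l unfolding c'_def A C class_of_def by (auto split: if_splits)
    then have "card (class_of n c' v) \<le> card (class_of n c v)" by (intro card_mono) auto
    then show ?thesis using pos[OF that, of c'] unfolding g_def by (simp add: log_le_cancel_iff)
  qed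
  have fin: "finite A" "finite B" using A B C by auto
  have AB: "card C = card A + card B" using fin unfolding A B
    by (metis Int_Diff_Un Int_Diff_disjoint card_Un_disjoint)
  have clA: "class_of n c v = C" "class_of n c' v = A" if "v \<in> A" for v
    using that l unfolding c'_def A C class_of_def by (auto split: if_splits)
  have clB: "class_of n c v = C" "class_of n c' v = B" if "v \<in> B" for v
    using that l unfolding c'_def A B C class_of_def by (auto split: if_splits)
  have g_ge: "1 \<le> log 2 (real (card C)) - log 2 (real (card X))" if "X \<noteq> {}" "finite X" "2 * card X \<le> card C" for X
  proof -
    have x: "0 < card X" using that by (simp add: card_gt_0_iff)
    have "1 + log 2 (real (card X)) = log 2 (real (2 * card X))" using x by (simp add: log_mult)
    also have "\<dots> \<le> log 2 (real (card C))" using x that by (subst log_le_cancel_iff) auto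
    finally show ?thesis by simp
  qed
  have sub: "A \<subseteq> {..<n}" "B \<subseteq> {..<n}" unfolding A B C class_of_def by auto
  obtain X where X: "X \<subseteq> {..<n}" "card X = min (card A) (card B)" "\<And>v. v \<in> X \<Longrightarrow> 1 \<le> g v"
  proof (cases "card A \<le> card B")
    case True
    then show ?thesis using that[of A] sub g_ge[of A] assms(5) fin AB clA unfolding g_def by simp
  next
    case False
    then show ?thesis using that[of B] sub g_ge[of B] assms(6) fin AB clB unfolding g_def by simp
  qed
  have "real (min (card A) (card B)) = (\<Sum>v\<in>X. 1)" using X by simp
  also have "\<dots> \<le> (\<Sum>v\<in>X. g v)" using X by (intro sum_mono) auto
  also have "\<dots> \<le> (\<Sum>v<n. g v)" using X g_nonneg by (intro sum_mono2) auto
  also have "\<dots> = potential n c - potential n c'" unfolding g_def potential_def by (simp add: sum_subtractf)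
  finally show "potential n c' + real (min (card A) (card B)) \<le> potential n c" by simp
qed

text \<open>Take a minimiser among the refinements of \<open>c\<close> with colours below
  \<open>n\<close>. Splitting a class along \<open>S\<close> would add the cut weight and save at
  least \<open>L\<close> times the smaller side, so the cut must be at least that heavy; comparison
  with \<open>c\<close> itself gives the last claim.\<close>

lemma sparse_refinement:
  fixes c :: "nat \<Rightarrow> nat" and L :: real
  assumes c: "\<And>v. v < n \<Longrightarrow> c v < n" and "L \<ge> 0"
  obtains c' where "\<And>v. v < n \<Longrightarrow> c' v < n"
    and "\<And>u v. u < n \<Longrightarrow> v < n \<Longrightarrow> c' u = c' v \<Longrightarrow> c u = c v"
    and "\<And>S v. L * real (min (card (class_of n c' v \<inter> S)) (card (class_of n c' v - S)))
           \<le> ucut n a (class_of n c' v \<inter> S) (class_of n c' v - S)"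
    and "cross_weight n a c' + L * potential n c' \<le> cross_weight n a c + L * potential n c"
proof -
  define X where "X = {d \<in> PiE {..<n} (\<lambda>_. {..<n}). \<forall>u<n. \<forall>v<n. d u = d v \<longrightarrow> c u = c v}"
  define F where "F = (\<lambda>d. cross_weight n a d + L * potential n d)"
  have F_cong: "F d = F d'" if "\<And>v. v < n \<Longrightarrow> d v = d' v" for d d'
  proof -
    have "class_of n d v = class_of n d' v" if "v < n" for v
      using that \<open>\<And>v. v < n \<Longrightarrow> d v = d' v\<close> unfolding class_of_def by auto
    then show ?thesis using that unfolding F_def cross_weight_def potential_def by simp
  qed
  have in_X: "restrict d {..<n} \<in> X"
    if "\<And>v. v < n \<Longrightarrow> d v < n" "\<And>u v. u < n \<Longrightarrow> v < n \<Longrightarrow> d u = d v \<Longrightarrow> c u = c v" for d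
  proof -
    have "restrict d {..<n} \<in> PiE {..<n} (\<lambda>_. {..<n})" using that(1) by auto
    moreover have "c u = c v" if "u < n" "v < n" "restrict d {..<n} u = restrict d {..<n} v" for u v
      using \<open>\<And>u v. u < n \<Longrightarrow> v < n \<Longrightarrow> d u = d v \<Longrightarrow> c u = c v\<close>[of u v] that by simp
    ultimately show ?thesis unfolding X_def by blast
  qed
  have "finite (PiE {..<n} (\<lambda>_. {..<n}))" by (intro finite_PiE) auto
  then have "finite X" by (rule rev_finite_subset) (auto simp only: X_def)
  moreover have "X \<noteq> {}" using in_X[of c] c by blast
  ultimately obtain c' where c': "c' \<in> X" "\<And>d. d \<in> X \<Longrightarrow> F c' \<le> F d"
    using ex_min_if_finite[of "F ` X"] by (auto simp: not_less)
  have minimal: "F c' \<le> F d"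
    if "\<And>v. v < n \<Longrightarrow> d v < n" "\<And>u v. u < n \<Longrightarrow> v < n \<Longrightarrow> d u = d v \<Longrightarrow> c u = c v" for d
  proof -
    have "F (restrict d {..<n}) = F d" by (rule F_cong) simp
    then show ?thesis using c'(2)[OF in_X[of d]] that by metis
  qed
  have c'n: "c' v < n" if "v < n" for v using c'(1) that unfolding X_def by auto
  have ref: "c u = c v" if "u < n" "v < n" "c' u = c' v" for u v using c'(1) that unfolding X_def by blast
  have sparse: "L * real (min (card (class_of n c' w \<inter> S)) (card (class_of n c' w - S)))
           \<le> ucut n a (class_of n c' w \<inter> S) (class_of n c' w - S)" for S w
  proof -
    define C A B where "C = class_of n c' w" and "A = C \<inter> S" and "B = C - S"
    show ?thesis
    proof (cases "A = {} \<or> B = {}")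
      case True
      then have "min (card A) (card B) = 0" by (metis card.empty min_0L min_0R)
      moreover have "0 \<le> ucut n a A B" unfolding ucut_def by (intro sum_nonneg) auto
      ultimately show ?thesis unfolding A_def B_def C_def by simp
    next
      case False
      then obtain u v where uv: "u \<in> A" "v \<in> B" by auto
      then have uv': "u < n" "v < n" "u \<noteq> v" "c' u = c' v" unfolding A_def B_def C_def class_of_def by auto
      \<comment> \<open>Two distinct vertices of equal colour make \<open>c'\<close> non-injective
        on \<open>n\<close> vertices, so one of the \<open>n\<close> colours is free for the
        split.\<close>
      have "c' ` {..<n} \<noteq> {..<n}"
      proof
        assume "c' ` {..<n} = {..<n}"
        then have "inj_on c' {..<n}" by (simp add: eq_card_imp_inj_on)
        then show False using uv' by (auto dest: inj_onD)
      qed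
      then obtain l where l: "l < n" "l \<notin> c' ` {..<n}" using c'n by blast
      define d where "d = (\<lambda>u. if u \<in> A then l else c' u)"
      have "F c' \<le> F d"
      proof (rule minimal)
        show "d v < n" if "v < n" for v using that l c'n unfolding d_def by auto
        show "c u = c v" if "u < n" "v < n" "d u = d v" for u v
        proof (cases "u \<in> A \<longleftrightarrow> v \<in> A")
          case True
          then have "c' u = c' v" using that unfolding d_def A_def C_def class_of_def by (auto split: if_splits)
          then show ?thesis using ref that by blast
        next
          case False
          then show ?thesis using that l unfolding d_def by (auto split: if_splits)
        qed
      qed
      moreover have "cross_weight n a d = cross_weight n a c' + ucut n a A B"
        and *: "potential n d + real (min (card A) (card B)) \<le> potential n c'"
        using split_class(1)[where a = a, OF l(2) C_def A_def B_def] split_class(2)[OF l(2) C_def A_def B_def]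
          False unfolding d_def by auto
      moreover have "L * (potential n d + real (min (card A) (card B))) \<le> L * potential n c'"
        using * assms(2) by (rule mult_left_mono)
      ultimately show ?thesis unfolding F_def A_def B_def C_def by (simp add: distrib_left)
    qed
  qed
  have "F c' \<le> F c" by (rule minimal) (use c in auto)
  then have "cross_weight n a c' + L * potential n c' \<le> cross_weight n a c + L * potential n c"
    unfolding F_def .
  with c'n ref sparse show ?thesis by (rule that[of c'])
qed

text \<open>Level 0 is the one-class partition: its factor \<open>1 / n\<close> times a side of at
  most \<open>n\<close> vertices is at most 1, which connectivity supplies. Later levels come from
  \<open>sparse_refinement\<close> with the factor doubled each time, chained by dependent
  choice.\<close>

lemma sparse_hierarchy:
  assumes "n \<ge> 1"
    and conn: "\<And>S. S \<noteq> {} \<Longrightarrow> S \<subset> {..<n} \<Longrightarrow> 1 \<le> ucut n a S ({..<n} - S)"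
  obtains c :: "nat \<Rightarrow> nat \<Rightarrow> nat" where "\<And>i v. v < n \<Longrightarrow> c i v < n"
    and "\<And>v. c 0 v = 0"
    and "\<And>i u v. u < n \<Longrightarrow> v < n \<Longrightarrow> c (Suc i) u = c (Suc i) v \<Longrightarrow> c i u = c i v"
    and "\<And>i S v. 2 ^ i / real n * real (min (card (class_of n (c i) v \<inter> S)) (card (class_of n (c i) v - S)))
           \<le> ucut n a (class_of n (c i) v \<inter> S) (class_of n (c i) v - S)"
    and "\<And>i. cross_weight n a (c (Suc i)) + 2 ^ Suc i / real n * potential n (c (Suc i))
           \<le> cross_weight n a (c i) + 2 ^ Suc i / real n * potential n (c i)"
proof -
  define P where "P = (\<lambda>i c. (\<forall>v<n. c v < n) \<and> (i = 0 \<longrightarrow> c = (\<lambda>_. 0))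
    \<and> (\<forall>S v. 2 ^ i / real n * real (min (card (class_of n c v \<inter> S)) (card (class_of n c v - S)))
           \<le> ucut n a (class_of n c v \<inter> S) (class_of n c v - S)))"
  define Q where "Q = (\<lambda>i (c::nat \<Rightarrow> nat) c'. (\<forall>u<n. \<forall>v<n. c' u = c' v \<longrightarrow> c u = c v)
    \<and> cross_weight n a c' + 2 ^ Suc i / real n * potential n c'
           \<le> cross_weight n a c + 2 ^ Suc i / real n * potential n c)"
  have "P 0 (\<lambda>_. 0)"
    unfolding P_def
  proof (intro conjI allI impI)
    fix S v
    let ?C = "class_of n (\<lambda>_. 0) v"
    have C: "?C = {..<n}" unfolding class_of_def by auto
    have "{..<n} - {..<n} \<inter> S = {..<n} - S" by auto
    show "2 ^ 0 / real n * real (min (card (?C \<inter> S)) (card (?C - S))) \<le> ucut n a (?C \<inter> S) (?C - S)"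
    proof (cases "{..<n} \<inter> S = {} \<or> {..<n} - S = {}")
      case True
      then have "min (card ({..<n} \<inter> S)) (card ({..<n} - S)) = 0" by (metis card.empty min_0L min_0R)
      moreover have "0 \<le> ucut n a (?C \<inter> S) (?C - S)" unfolding ucut_def by (intro sum_nonneg) auto
      ultimately show ?thesis unfolding C by simp
    next
      case False
      then have "1 \<le> ucut n a ({..<n} \<inter> S) ({..<n} - {..<n} \<inter> S)" by (intro conn) auto
      moreover have "card ({..<n} \<inter> S) \<le> n" using card_mono[of "{..<n}" "{..<n} \<inter> S"] by auto
      then have "real (min (card ({..<n} \<inter> S)) (card ({..<n} - S))) / n \<le> 1" using assms(1) by simp
      ultimately show ?thesis unfolding C using \<open>{..<n} - {..<n} \<inter> S = {..<n} - S\<close> by simp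
    qed
  qed (use assms in auto)
  moreover have "\<exists>c'. P (Suc i) c' \<and> Q i c c'" if "P i c" for i c
  proof -
    have c: "\<And>v. v < n \<Longrightarrow> c v < n" using that unfolding P_def by blast
    have L: "(0::real) \<le> 2 ^ Suc i / real n" by simp
    obtain c' where "\<And>v. v < n \<Longrightarrow> c' v < n"
      and "\<And>u v. u < n \<Longrightarrow> v < n \<Longrightarrow> c' u = c' v \<Longrightarrow> c u = c v"
      and "\<And>S v. 2 ^ Suc i / real n * real (min (card (class_of n c' v \<inter> S)) (card (class_of n c' v - S)))
           \<le> ucut n a (class_of n c' v \<inter> S) (class_of n c' v - S)"
      and "cross_weight n a c' + 2 ^ Suc i / real n * potential n c'
           \<le> cross_weight n a c + 2 ^ Suc i / real n * potential n c"
      using sparse_refinement[where n = n and c = c and a = a, OF c L] by blast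
    then have "P (Suc i) c'" "Q i c c'" unfolding P_def Q_def by blast+
    then show ?thesis by blast
  qed
  ultimately obtain c where P: "\<And>i. P i (c i)" and Q: "\<And>i. Q i (c i) (c (Suc i))"
    using dependent_nat_choice[of P Q] by blast
  show ?thesis
  proof (rule that[of c])
    show "c 0 v = 0" for v using P[of 0] unfolding P_def by simp
  qed (use P Q in \<open>unfold P_def Q_def, blast+\<close>)
qed

subsection \<open>The estimator\<close>

definition dcut :: "nat \<Rightarrow> (nat \<Rightarrow> nat \<Rightarrow> nat) \<Rightarrow> nat set \<Rightarrow> real" where
  "dcut n a S = (\<Sum>u<n. \<Sum>v<n. if u \<in> S \<and> v \<notin> S then real (a u v) else 0)"

text \<open>The disjunct \<open>h \<le> Suc i\<close> makes the level well defined from \<open>c 0, ..., c (h - 1)\<close> alone, also for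
  \<open>u = v\<close>.\<close>
definition level :: "nat \<Rightarrow> (nat \<Rightarrow> nat \<Rightarrow> nat) \<Rightarrow> nat \<Rightarrow> nat \<Rightarrow> nat" where
  "level h c u v = (LEAST i. h \<le> Suc i \<or> c (Suc i) u \<noteq> c (Suc i) v)"

definition small_inside :: "nat \<Rightarrow> (nat \<Rightarrow> nat \<Rightarrow> nat) \<Rightarrow> nat set \<Rightarrow> nat \<Rightarrow> nat \<Rightarrow> bool" where
  "small_inside n c S i v \<longleftrightarrow> card (class_of n (c i) v \<inter> S) \<le> card (class_of n (c i) v - S)"

text \<open>The factor \<open>2 ^ i / (n * R)\<close> bounds a light edge of level \<open>i\<close>,
  so this is twice the most light weight that a vertex can send to, or receive from, the smaller
  side at that level.\<close>

definition threshold :: "nat \<Rightarrow> real \<Rightarrow> (nat \<Rightarrow> nat \<Rightarrow> nat) \<Rightarrow> nat set \<Rightarrow> nat \<Rightarrow> nat \<Rightarrow> real" where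
  "threshold n R c S i v = 2 * (2 ^ i / (real n * R)) *
     real (min (card (class_of n (c i) v \<inter> S)) (card (class_of n (c i) v - S)))"

text \<open>The vertices for which the estimator uses the exact degree minus the sampled inner edges, rather than the
  sampled cut edges.\<close>
definition out_exact where
  "out_exact n R c dout S i u \<longleftrightarrow>
     u \<in> S \<and> small_inside n c S i u \<and> threshold n R c S i u < real (dout i u :: nat)"

definition in_exact where
  "in_exact n R c din S i v \<longleftrightarrow>
     v \<notin> S \<and> \<not> small_inside n c S i v \<and> threshold n R c S i v < real (din i v :: nat)"

text \<open>A crossing edge counts 1, and every exact degree that contains the edge takes 1 off. So
  an edge of an exact vertex counts 0 if it crosses and -1 if it stays on the side of that
  vertex.\<close>

definition coefficient ::
  "nat \<Rightarrow> real \<Rightarrow> nat \<Rightarrow> nat set \<Rightarrow> (nat \<Rightarrow> nat \<Rightarrow> nat) \<Rightarrow> (nat \<Rightarrow> nat \<Rightarrow> nat) \<Rightarrow> (nat \<Rightarrow> nat \<Rightarrow> nat)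
    \<Rightarrow> nat \<Rightarrow> nat \<Rightarrow> real" where
  "coefficient n R h S c dout din u v = of_bool (u \<in> S \<and> v \<notin> S)
     - of_bool (out_exact n R c dout S (level h c u v) u)
     - of_bool (in_exact n R c din S (level h c u v) v)"

definition estimate ::
  "nat \<Rightarrow> real \<Rightarrow> nat \<Rightarrow> nat set \<Rightarrow> (nat \<Rightarrow> nat \<Rightarrow> nat) \<Rightarrow> (nat \<Rightarrow> nat \<Rightarrow> nat) \<Rightarrow> (nat \<Rightarrow> nat \<Rightarrow> nat)
    \<Rightarrow> (nat \<Rightarrow> nat \<Rightarrow> nat) \<Rightarrow> (nat \<Rightarrow> nat \<Rightarrow> nat) \<Rightarrow> real" where
  "estimate n R h S c dout din heavy t = dcut n heavy S
     + (\<Sum>u<n. \<Sum>v<n. coefficient n R h S c dout din u v * real (t u v))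
     + (\<Sum>i<h. \<Sum>u<n. if out_exact n R c dout S i u then real (dout i u) else 0)
     + (\<Sum>i<h. \<Sum>v<n. if in_exact n R c din S i v then real (din i v) else 0)"

lemma level_less: "0 < h \<Longrightarrow> level h c u v < h"
  using Least_le[of "\<lambda>i. h \<le> Suc i \<or> c (Suc i) u \<noteq> c (Suc i) v" "h - 1"]
  unfolding level_def by simp

lemma level_cong:
  assumes "\<And>i. i < h \<Longrightarrow> c i u = c' i u" "\<And>i. i < h \<Longrightarrow> c i v = c' i v"
  shows "level h c u v = level h c' u v"
  unfolding level_def using assms by (intro arg_cong[where f = Least] ext) (auto simp: not_le)

text \<open>For decoding: a finite message holds the arrays only for levels below \<open>h\<close>
  and vertices below \<open>n\<close>, and the estimate must not depend on the rest.\<close>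

lemma estimate_cong:
  assumes "0 < h"
    and c: "\<And>i v. i < h \<Longrightarrow> v < n \<Longrightarrow> c i v = c' i v"
    and d: "\<And>i v. i < h \<Longrightarrow> v < n \<Longrightarrow> dout i v = dout' i v"
      "\<And>i v. i < h \<Longrightarrow> v < n \<Longrightarrow> din i v = din' i v"
    and t: "\<And>u v. u < n \<Longrightarrow> v < n \<Longrightarrow> heavy u v = heavy' u v"
      "\<And>u v. u < n \<Longrightarrow> v < n \<Longrightarrow> t u v = t' u v"
  shows "estimate n R h S c dout din heavy t = estimate n R h S c' dout' din' heavy' t'"
proof -
  have cl: "class_of n (c i) v = class_of n (c' i) v" if "i < h" "v < n" for i v
    using that c unfolding class_of_def by auto
  have ex: "out_exact n R c dout S i v = out_exact n R c' dout' S i v"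
    "in_exact n R c din S i v = in_exact n R c' din' S i v" if "i < h" "v < n" for i v
    using that cl d unfolding out_exact_def in_exact_def small_inside_def threshold_def by auto
  have "level h c u v = level h c' u v" if "u < n" "v < n" for u v
    using that c by (intro level_cong) auto
  then have co: "coefficient n R h S c dout din u v = coefficient n R h S c' dout' din' u v"
    if "u < n" "v < n" for u v
    using that ex level_less[OF assms(1)] unfolding coefficient_def by simp
  have "dcut n heavy S = dcut n heavy' S" unfolding dcut_def using t by (intro sum.cong) auto
  moreover have "(\<Sum>u<n. \<Sum>v<n. coefficient n R h S c dout din u v * real (t u v))
     = (\<Sum>u<n. \<Sum>v<n. coefficient n R h S c' dout' din' u v * real (t' u v))"
    using t co by (intro sum.cong) auto
  moreover have "(\<Sum>i<h. \<Sum>u<n. if out_exact n R c dout S i u then real (dout i u) else 0)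
      = (\<Sum>i<h. \<Sum>u<n. if out_exact n R c' dout' S i u then real (dout' i u) else 0)"
    using ex d by (intro sum.cong) auto
  moreover have "(\<Sum>i<h. \<Sum>v<n. if in_exact n R c din S i v then real (din i v) else 0)
      = (\<Sum>i<h. \<Sum>v<n. if in_exact n R c' din' S i v then real (din' i v) else 0)"
    using ex d by (intro sum.cong) auto
  ultimately show ?thesis unfolding estimate_def by simp
qed

lemma heavy_half_outside:
  fixes f :: "nat \<Rightarrow> real"
  assumes "finite J" and f: "\<And>v. v \<in> J \<Longrightarrow> 0 \<le> f v \<and> f v \<le> \<kappa>" and "\<kappa> \<ge> 0"
    and "card (J \<inter> X) \<le> m" "2 * \<kappa> * real m < (\<Sum>v\<in>J. f v)"
  shows "(\<Sum>v\<in>J \<inter> X. f v) \<le> \<kappa> * real m" "(\<Sum>v\<in>J. f v) \<le> 2 * (\<Sum>v\<in>J - X. f v)"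
proof -
  have "(\<Sum>v\<in>J \<inter> X. f v) \<le> (\<Sum>v\<in>J \<inter> X. \<kappa>)" using f by (intro sum_mono) auto
  also have "\<dots> \<le> \<kappa> * real m" using assms by (simp add: mult.commute mult_left_mono)
  finally show 1: "(\<Sum>v\<in>J \<inter> X. f v) \<le> \<kappa> * real m" .
  have "(\<Sum>v\<in>J. f v) = (\<Sum>v\<in>J \<inter> X. f v) + (\<Sum>v\<in>J - X. f v)"
    using assms(1) by (metis sum.Int_Diff)
  with 1 assms(5) show "(\<Sum>v\<in>J. f v) \<le> 2 * (\<Sum>v\<in>J - X. f v)" by simp
qed

section \<open>Edge levels in a sparse hierarchy, light and heavy edges\<close>

locale sparse_levels =
  fixes n :: nat and a :: "nat \<Rightarrow> nat \<Rightarrow> nat" and c :: "nat \<Rightarrow> nat \<Rightarrow> nat" and h :: nat and R :: real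
  assumes n: "n \<ge> 2" and R: "R \<ge> 1" and diag: "a u u = 0"
    and c_less: "v < n \<Longrightarrow> c i v < n" and c_0: "c 0 v = 0"
    and nested: "u < n \<Longrightarrow> v < n \<Longrightarrow> c (Suc i) u = c (Suc i) v \<Longrightarrow> c i u = c i v"
    and sparse: "2 ^ i / real n * real (min (card (class_of n (c i) v \<inter> S)) (card (class_of n (c i) v - S)))
           \<le> ucut n a (class_of n (c i) v \<inter> S) (class_of n (c i) v - S)"
    and decrease: "cross_weight n a (c (Suc i)) + 2 ^ Suc i / real n * potential n (c (Suc i))
           \<le> cross_weight n a (c i) + 2 ^ Suc i / real n * potential n (c i)"
    and separated: "u < n \<Longrightarrow> v < n \<Longrightarrow> u \<noteq> v \<Longrightarrow> c h u \<noteq> c h v"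
begin

abbreviation "lev \<equiv> level h c"

definition "light u v = (if real (a u v) \<le> 2 ^ lev u v / (real n * R) then a u v else 0)"
definition "heavy u v = (if real (a u v) \<le> 2 ^ lev u v / (real n * R) then 0 else a u v)"
definition "dout i u = (\<Sum>v<n. if lev u v = i then light u v else 0)"
definition "din i v = (\<Sum>u<n. if lev u v = i then light u v else 0)"

text \<open>An edge is kept with probability \<open>light u v / kept u v\<close> and then stored with weight \<open>kept u v\<close>, so that
  the stored weight is an integer and unbiased.\<close>
definition "kept u v = max (light u v) (nat \<lfloor>real (min (dout (lev u v) u) (din (lev u v) v)) / R\<rfloor>)"

lemma h_pos: "0 < h"
proof (rule ccontr)
  assume "\<not> 0 < h"
  then show False using separated[of 0 1] c_0 n by simp
qed

lemma nested_le:
  assumes "i \<le> j" "u < n" "v < n" "c j u = c j v"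
  shows "c i u = c i v"
  using assms(1,4)
proof (induction rule: dec_induct)
  case (step k)
  then show ?case using nested[OF assms(2,3)] by blast
qed

lemma lev_less: "lev u v < h"
  using level_less h_pos by blast

lemma lev_eq_iff:
  assumes "u < n" "v < n" "u \<noteq> v"
  shows "lev u v = i \<longleftrightarrow> c i u = c i v \<and> c (Suc i) u \<noteq> c (Suc i) v"
proof -
  let ?P = "\<lambda>i. h \<le> Suc i \<or> c (Suc i) u \<noteq> c (Suc i) v"
  have 1: "?P (lev u v)"
    unfolding level_def by (rule LeastI[of ?P h]) simp
  have "Suc (lev u v) \<le> h" using lev_less by (simp add: Suc_le_eq)
  \<comment> \<open>If the search was stopped by the cap, the level is \<open>h - 1\<close>, and
    \<open>separated\<close> still tells the endpoints apart on the next level.\<close>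
  then have 2: "c (Suc (lev u v)) u \<noteq> c (Suc (lev u v)) v" using 1 separated[OF assms] by (auto dest: le_antisym)
  have 3: "c (lev u v) u = c (lev u v) v"
  proof (cases "lev u v")
    case 0
    then show ?thesis by (simp add: c_0)
  next
    case (Suc j)
    then have "\<not> ?P j" using not_less_Least[of j ?P] unfolding level_def by auto
    then show ?thesis using Suc by simp
  qed
  show ?thesis
  proof
    assume *: "c i u = c i v \<and> c (Suc i) u \<noteq> c (Suc i) v"
    have "i < Suc (lev u v)" using 2 nested_le[of "Suc (lev u v)" i u v] * assms by (meson not_less)
    moreover have "lev u v < Suc i" using 3 nested_le[of "Suc i" "lev u v" u v] * assms by (meson not_less)
    ultimately show "lev u v = i" by simp
  qed (use 2 3 in auto)
qed

lemma same_class: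
  assumes "u < n" "v < n"
  shows "c (lev u v) u = c (lev u v) v"
  using lev_eq_iff[OF assms, of "lev u v"] by (cases "u = v") auto

lemma class_of_lev:
  assumes "u < n" "v < n"
  shows "class_of n (c (lev u v)) u = class_of n (c (lev u v)) v"
  using same_class[OF assms] unfolding class_of_def by simp

lemma light_heavy: "a u v = light u v + heavy u v"
  unfolding light_def heavy_def by simp

lemma light_le: "light u v \<le> a u v"
  unfolding light_def by simp

lemma light_bound: "real (light u v) \<le> 2 ^ lev u v / (real n * R)"
  unfolding light_def using R by simp

lemma sum_by_level:
  fixes f :: "nat \<Rightarrow> nat \<Rightarrow> real"
  shows "(\<Sum>i<h. \<Sum>u<n. \<Sum>v<n. if lev u v = i then f u v else 0) = (\<Sum>u<n. \<Sum>v<n. f u v)"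
proof -
  have "(\<Sum>i<h. \<Sum>u<n. \<Sum>v<n. if lev u v = i then f u v else 0)
     = (\<Sum>u<n. \<Sum>v<n. \<Sum>i<h. if lev u v = i then f u v else 0)"
    by (rule trans[OF sum.swap], rule sum.cong[OF refl], rule sum.swap)
  also have "\<dots> = (\<Sum>u<n. \<Sum>v<n. f u v)"
    using lev_less by (intro sum.cong refl) (simp add: sum.delta')
  finally show ?thesis .
qed

section \<open>Degrees per level and the error of the estimator\<close>

lemma real_dout: "real (dout i u) = (\<Sum>v<n. if lev u v = i then real (light u v) else 0)"
  unfolding dout_def of_nat_sum by (intro sum.cong) auto

lemma real_din: "real (din i v) = (\<Sum>u<n. if lev u v = i then real (light u v) else 0)"
  unfolding din_def of_nat_sum by (intro sum.cong) auto

lemma sum_out_degrees: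
  "(\<Sum>i<h. \<Sum>u<n. if P i u then real (dout i u) else 0)
   = (\<Sum>u<n. \<Sum>v<n. of_bool (P (lev u v) u) * real (light u v))"
proof -
  have "(\<Sum>i<h. \<Sum>u<n. if P i u then real (dout i u) else 0)
     = (\<Sum>i<h. \<Sum>u<n. \<Sum>v<n. if lev u v = i then of_bool (P (lev u v) u) * real (light u v) else 0)"
    unfolding real_dout by (intro sum.cong refl) (simp cong: if_cong)
  then show ?thesis by (simp only: sum_by_level)
qed

lemma sum_in_degrees:
  "(\<Sum>i<h. \<Sum>v<n. if P i v then real (din i v) else 0)
   = (\<Sum>u<n. \<Sum>v<n. of_bool (P (lev u v) v) * real (light u v))"
proof -
  have "(\<Sum>i<h. \<Sum>v<n. if P i v then real (din i v) else 0)
     = (\<Sum>i<h. \<Sum>v<n. \<Sum>u<n. if lev u v = i then of_bool (P (lev u v) v) * real (light u v) else 0)"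
    unfolding real_din by (intro sum.cong refl) (simp cong: if_cong)
  also have "\<dots> = (\<Sum>i<h. \<Sum>u<n. \<Sum>v<n. if lev u v = i then of_bool (P (lev u v) v) * real (light u v) else 0)"
    by (rule sum.cong[OF refl], rule sum.swap)
  finally show ?thesis by (simp only: sum_by_level)
qed

text \<open>The estimate is affine in the samples and exact when \<open>t\<close> equals
  \<open>light\<close>: heavy edges are stored, and the indicators subtracted in
  \<open>coefficient\<close> cancel the exact degrees. Only the deviations of the samples from the
  light weights remain.\<close>

lemma estimate_error:
  fixes t :: "nat \<Rightarrow> nat \<Rightarrow> nat"
  shows "estimate n R h S c dout din heavy t - dcut n a S
   = (\<Sum>u<n. \<Sum>v<n. coefficient n R h S c dout din u v * (real (t u v) - real (light u v)))"
proof -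
  let ?k = "\<lambda>u v. coefficient n R h S c dout din u v"
  let ?o = "\<lambda>u v. of_bool (out_exact n R c dout S (lev u v) u) * real (light u v)"
  let ?i = "\<lambda>u v. of_bool (in_exact n R c din S (lev u v) v) * real (light u v)"
  let ?c = "\<lambda>u v. of_bool (u \<in> S \<and> v \<notin> S) * real (light u v)"
  have "(if u \<in> S \<and> v \<notin> S then real (a u v) else 0)
      = (if u \<in> S \<and> v \<notin> S then real (heavy u v) else 0) + ?c u v" for u v
    using light_heavy[of u v] by simp
  then have 1: "dcut n a S = dcut n heavy S + (\<Sum>u<n. \<Sum>v<n. ?c u v)"
    unfolding dcut_def by (simp only: sum.distrib)
  have "?k u v * (real (t u v) - real (light u v)) = ?k u v * real (t u v) + ?o u v + ?i u v - ?c u v" for u v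
    unfolding coefficient_def by (simp only: left_diff_distrib right_diff_distrib)
  then have 2: "(\<Sum>u<n. \<Sum>v<n. ?k u v * (real (t u v) - real (light u v)))
      = (\<Sum>u<n. \<Sum>v<n. ?k u v * real (t u v)) + (\<Sum>u<n. \<Sum>v<n. ?o u v)
        + (\<Sum>u<n. \<Sum>v<n. ?i u v) - (\<Sum>u<n. \<Sum>v<n. ?c u v)"
    by (simp only: sum.distrib sum_subtractf)
  show ?thesis
    unfolding estimate_def sum_out_degrees[of "out_exact n R c dout S"] sum_in_degrees[of "in_exact n R c din S"] 1 2
    by simp
qed

text \<open>Both endpoints lie in the same class at the level of the edge, so
  \<open>small_inside\<close> agrees on them and the two exact modes exclude each other. The four
  cases are the only sources of noise: crossing edges with a small degree at one end, and inner
  edges of exact vertices.\<close>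

lemma coefficient_cases:
  fixes S :: "nat set"
  assumes "u < n" "v < n"
  defines "\<sigma> \<equiv> coefficient n R h S c dout din u v" and "i \<equiv> lev u v"
  shows "\<bar>\<sigma>\<bar> \<le> 1"
    and "\<sigma> \<noteq> 0 \<Longrightarrow>
      (u \<in> S \<and> v \<notin> S \<and> small_inside n c S i u \<and> real (dout i u) \<le> threshold n R c S i u) \<or>
      (u \<in> S \<and> v \<notin> S \<and> \<not> small_inside n c S i v \<and> real (din i v) \<le> threshold n R c S i v) \<or>
      (u \<in> S \<and> v \<in> S \<and> out_exact n R c dout S i u) \<or>
      (u \<notin> S \<and> v \<notin> S \<and> in_exact n R c din S i v)"
proof -
  have sm: "small_inside n c S i u = small_inside n c S i v"
    unfolding small_inside_def i_def class_of_lev[OF assms(1,2)] ..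
  then show "\<bar>\<sigma>\<bar> \<le> 1"
    unfolding \<sigma>_def coefficient_def out_exact_def in_exact_def i_def by auto
  show "\<sigma> \<noteq> 0 \<Longrightarrow>
      (u \<in> S \<and> v \<notin> S \<and> small_inside n c S i u \<and> real (dout i u) \<le> threshold n R c S i u) \<or>
      (u \<in> S \<and> v \<notin> S \<and> \<not> small_inside n c S i v \<and> real (din i v) \<le> threshold n R c S i v) \<or>
      (u \<in> S \<and> v \<in> S \<and> out_exact n R c dout S i u) \<or>
      (u \<notin> S \<and> v \<notin> S \<and> in_exact n R c din S i v)"
    using sm unfolding \<sigma>_def coefficient_def out_exact_def in_exact_def i_def
    by (cases "u \<in> S"; cases "v \<in> S") auto
qed

text \<open>Sparsity bounds \<open>2 ^ i / n\<close> times the smaller side by the cut inside one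
  class, which is part of the whole undirected cut.\<close>

lemma threshold_le: "threshold n R c S i v \<le> 2 * ucut n a S ({..<n} - S) / R"
proof -
  let ?C = "class_of n (c i) v"
  have "2 ^ i / real n * real (min (card (?C \<inter> S)) (card (?C - S))) \<le> ucut n a S ({..<n} - S)"
    by (rule order_trans[OF sparse ucut_mono]) (auto simp: class_of_def)
  then have "2 / R * (2 ^ i / real n * real (min (card (?C \<inter> S)) (card (?C - S)))) \<le> 2 / R * ucut n a S ({..<n} - S)"
    using R by (intro mult_left_mono) auto
  then show ?thesis unfolding threshold_def by (simp add: field_simps)
qed

text \<open>All level-\<open>i\<close> neighbours of \<open>u\<close> lie in its class, and
  \<open>small_inside\<close> makes the part of the class in \<open>S\<close> the smaller one.
  Exceeding the threshold is then the hypothesis of \<open>heavy_half_outside\<close>, with the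
  bound on light edges as \<open>\<kappa>\<close>.\<close>

lemma out_exact_bounds:
  assumes u: "u < n" and ex: "out_exact n R c dout S i u"
  shows "(\<Sum>v<n. if lev u v = i \<and> v \<in> S then real (light u v) else 0) \<le> ucut n a S ({..<n} - S) / R"
    and "real (dout i u) \<le> 2 * (\<Sum>v<n. if lev u v = i \<and> v \<notin> S then real (light u v) else 0)"
proof -
  let ?C = "class_of n (c i) u"
  define J where "J = {v. v < n \<and> lev u v = i}"
  define \<kappa> where "\<kappa> = 2 ^ i / (real n * R)"
  define m where "m = card (?C \<inter> S)"
  have "J \<subseteq> ?C" using u same_class unfolding J_def class_of_def by force
  then have "card (J \<inter> S) \<le> m" unfolding m_def by (intro card_mono) auto
  have sm: "min (card (?C \<inter> S)) (card (?C - S)) = m"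
    using ex unfolding out_exact_def small_inside_def m_def by simp
  have "(\<Sum>v\<in>J. real (light u v)) = real (dout i u)"
    unfolding real_dout J_def by (rule sum.mono_neutral_cong_left) auto
  then have "2 * \<kappa> * real m < (\<Sum>v\<in>J. real (light u v))"
    using ex unfolding out_exact_def threshold_def sm \<kappa>_def by simp
  moreover have "0 \<le> real (light u v) \<and> real (light u v) \<le> \<kappa>" if "v \<in> J" for v
    using light_bound[of u v] that unfolding J_def \<kappa>_def by auto
  moreover have "finite J" unfolding J_def by simp
  moreover have "\<kappa> \<ge> 0" unfolding \<kappa>_def using R by simp
  ultimately have *: "(\<Sum>v\<in>J \<inter> S. real (light u v)) \<le> \<kappa> * real m"
    "(\<Sum>v\<in>J. real (light u v)) \<le> 2 * (\<Sum>v\<in>J - S. real (light u v))"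
    using heavy_half_outside[of J "\<lambda>v. real (light u v)" \<kappa> S m] \<open>card (J \<inter> S) \<le> m\<close> by auto
  have "2 * (\<kappa> * real m) \<le> 2 * (ucut n a S ({..<n} - S) / R)"
    using threshold_le[of S i u] unfolding threshold_def sm \<kappa>_def by simp
  moreover have "(\<Sum>v<n. if lev u v = i \<and> v \<in> S then real (light u v) else 0) = (\<Sum>v\<in>J \<inter> S. real (light u v))"
    unfolding J_def by (rule sum.mono_neutral_cong_right) auto
  ultimately show "(\<Sum>v<n. if lev u v = i \<and> v \<in> S then real (light u v) else 0) \<le> ucut n a S ({..<n} - S) / R"
    using *(1) by simp
  have "(\<Sum>v<n. if lev u v = i \<and> v \<notin> S then real (light u v) else 0) = (\<Sum>v\<in>J - S. real (light u v))"
    unfolding J_def by (rule sum.mono_neutral_cong_right) auto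
  then show "real (dout i u) \<le> 2 * (\<Sum>v<n. if lev u v = i \<and> v \<notin> S then real (light u v) else 0)"
    using *(2) \<open>(\<Sum>v\<in>J. real (light u v)) = real (dout i u)\<close> by simp
qed

lemma in_exact_bounds:
  assumes v: "v < n" and ex: "in_exact n R c din S i v"
  shows "(\<Sum>u<n. if lev u v = i \<and> u \<notin> S then real (light u v) else 0) \<le> ucut n a S ({..<n} - S) / R"
    and "real (din i v) \<le> 2 * (\<Sum>u<n. if lev u v = i \<and> u \<in> S then real (light u v) else 0)"
proof -
  let ?C = "class_of n (c i) v"
  define J where "J = {u. u < n \<and> lev u v = i}"
  define \<kappa> where "\<kappa> = 2 ^ i / (real n * R)"
  define m where "m = card (?C - S)"
  have "J \<subseteq> ?C" using v same_class unfolding J_def class_of_def by force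
  \<comment> \<open>Mirror image of the outgoing case: the smaller side is now outside
    \<open>S\<close>, hence \<open>- S\<close> in place of \<open>S\<close>.\<close>
  then have "card (J \<inter> - S) \<le> m" unfolding m_def by (intro card_mono) auto
  have sm: "min (card (?C \<inter> S)) (card (?C - S)) = m"
    using ex unfolding in_exact_def small_inside_def m_def by simp
  have "(\<Sum>u\<in>J. real (light u v)) = real (din i v)"
    unfolding real_din J_def by (rule sum.mono_neutral_cong_left) auto
  then have "2 * \<kappa> * real m < (\<Sum>u\<in>J. real (light u v))"
    using ex unfolding in_exact_def threshold_def sm \<kappa>_def by simp
  moreover have "0 \<le> real (light u v) \<and> real (light u v) \<le> \<kappa>" if "u \<in> J" for u
    using light_bound[of u v] that unfolding J_def \<kappa>_def by auto
  moreover have "finite J" unfolding J_def by simp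
  moreover have "\<kappa> \<ge> 0" unfolding \<kappa>_def using R by simp
  ultimately have *: "(\<Sum>u\<in>J \<inter> - S. real (light u v)) \<le> \<kappa> * real m"
    "(\<Sum>u\<in>J. real (light u v)) \<le> 2 * (\<Sum>u\<in>J - (- S). real (light u v))"
    using heavy_half_outside[of J "\<lambda>u. real (light u v)" \<kappa> "- S" m] \<open>card (J \<inter> - S) \<le> m\<close> by auto
  have "2 * (\<kappa> * real m) \<le> 2 * (ucut n a S ({..<n} - S) / R)"
    using threshold_le[of S i v] unfolding threshold_def sm \<kappa>_def by simp
  moreover have "(\<Sum>u<n. if lev u v = i \<and> u \<notin> S then real (light u v) else 0) = (\<Sum>u\<in>J \<inter> - S. real (light u v))"
    unfolding J_def by (rule sum.mono_neutral_cong_right) auto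
  ultimately show "(\<Sum>u<n. if lev u v = i \<and> u \<notin> S then real (light u v) else 0) \<le> ucut n a S ({..<n} - S) / R"
    using *(1) by simp
  have "(\<Sum>u<n. if lev u v = i \<and> u \<in> S then real (light u v) else 0) = (\<Sum>u\<in>J - (- S). real (light u v))"
    unfolding J_def by (rule sum.mono_neutral_cong_right) auto
  then show "real (din i v) \<le> 2 * (\<Sum>u<n. if lev u v = i \<and> u \<in> S then real (light u v) else 0)"
    using *(2) \<open>(\<Sum>u\<in>J. real (light u v)) = real (din i v)\<close> by simp
qed

lemma kept_ge: "light u v \<le> kept u v"
  unfolding kept_def by simp

lemma kept_le:
  assumes "kept u v \<noteq> light u v"
  shows "real (kept u v) \<le> real (dout (lev u v) u) / R" "real (kept u v) \<le> real (din (lev u v) v) / R"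
proof -
  let ?m = "real (min (dout (lev u v) u) (din (lev u v) v)) / R"
  have "kept u v = nat \<lfloor>?m\<rfloor>" using assms unfolding kept_def by (auto simp: max_def split: if_splits)
  then have k: "real (kept u v) \<le> ?m" using R by simp
  have "?m \<le> real (dout (lev u v) u) / R" using R by (auto intro!: divide_right_mono)
  with k show "real (kept u v) \<le> real (dout (lev u v) u) / R" by (rule order_trans)
  have "?m \<le> real (din (lev u v) v) / R" using R by (auto intro!: divide_right_mono)
  with k show "real (kept u v) \<le> real (din (lev u v) v) / R" by (rule order_trans)
qed

section \<open>Magnitude and variance of the samples\<close>

lemma dcut_light: "dcut n light S \<le> dcut n a S"
  unfolding dcut_def using light_le by (intro sum_mono) auto

lemma ucut_nonneg: "0 \<le> ucut n a A B"
  unfolding ucut_def by (intro sum_nonneg) auto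

lemma out_row_le:
  assumes "u < n" "u \<in> S"
  shows "(\<Sum>v<n. if lev u v = i \<and> v \<notin> S then real (light u v) else 0) \<le> dcut n a S"
proof -
  have "(\<Sum>v<n. if lev u v = i \<and> v \<notin> S then real (light u v) else 0)
      \<le> (\<Sum>v<n. if u \<in> S \<and> v \<notin> S then real (light u v) else 0)"
    using assms by (intro sum_mono) auto
  also have "\<dots> \<le> dcut n light S"
    unfolding dcut_def using assms
    by (intro member_le_sum[where f = "\<lambda>u. \<Sum>v<n. if u \<in> S \<and> v \<notin> S then real (light u v) else 0"] sum_nonneg) auto
  finally show ?thesis using dcut_light order_trans by blast
qed

lemma in_row_le:
  assumes "v < n" "v \<notin> S"
  shows "(\<Sum>u<n. if lev u v = i \<and> u \<in> S then real (light u v) else 0) \<le> dcut n a S"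
proof -
  have "(\<Sum>u<n. if lev u v = i \<and> u \<in> S then real (light u v) else 0)
      \<le> (\<Sum>u<n. if u \<in> S \<and> v \<notin> S then real (light u v) else 0)"
    using assms by (intro sum_mono) auto
  also have "\<dots> \<le> (\<Sum>v<n. \<Sum>u<n. if u \<in> S \<and> v \<notin> S then real (light u v) else 0)"
    using assms
    by (intro member_le_sum[where f = "\<lambda>v. \<Sum>u<n. if u \<in> S \<and> v \<notin> S then real (light u v) else 0"] sum_nonneg) auto
  also have "\<dots> = dcut n light S" unfolding dcut_def by (rule sum.swap)
  finally show ?thesis using dcut_light order_trans by blast
qed

text \<open>The Bernstein bound needs a uniform bound on single noisy samples. A crossing one has a
  degree below the threshold, so at most \<open>2 * ucut / R\<close>; for an inner one at an exact
  vertex, at least half of the degree belongs to the directed cut. In both cases \<open>kept\<close>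
  is at most the degree divided by \<open>R\<close>.\<close>

lemma kept_magnitude:
  assumes uv: "u < n" "v < n" and "coefficient n R h S c dout din u v \<noteq> 0" "kept u v \<noteq> light u v"
  shows "real (kept u v) \<le> max (2 * ucut n a S ({..<n} - S) / R\<^sup>2) (2 * dcut n a S / R)"
proof -
  let ?i = "lev u v"
  have small: "x / R \<le> 2 * ucut n a S ({..<n} - S) / R\<^sup>2" if "x \<le> threshold n R c S ?i y" for x y
  proof -
    have "x / R \<le> (2 * ucut n a S ({..<n} - S) / R) / R"
      using that threshold_le[of S ?i y] R by (intro divide_right_mono) auto
    then show ?thesis by (simp add: power2_eq_square)
  qed
  have exact: "x / R \<le> 2 * dcut n a S / R" if "x \<le> 2 * y" "y \<le> dcut n a S" for x y :: real
    using that R by (intro divide_right_mono) auto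
  from coefficient_cases(2)[OF uv assms(3)] show ?thesis
  proof (elim disjE conjE)
    assume "real (dout ?i u) \<le> threshold n R c S ?i u"
    then show ?thesis using small kept_le(1)[OF assms(4)] by (meson max.coboundedI1 order_trans)
  next
    assume "real (din ?i v) \<le> threshold n R c S ?i v"
    then show ?thesis using small kept_le(2)[OF assms(4)] by (meson max.coboundedI1 order_trans)
  next
    assume "u \<in> S" "out_exact n R c dout S ?i u"
    then have "real (dout ?i u) / R \<le> 2 * dcut n a S / R"
      using exact out_exact_bounds(2)[OF uv(1)] out_row_le[OF uv(1)] by blast
    then show ?thesis using kept_le(1)[OF assms(4)] by (meson max.coboundedI2 order_trans)
  next
    assume "v \<notin> S" "in_exact n R c din S ?i v"
    then have "real (din ?i v) / R \<le> 2 * dcut n a S / R"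
      using exact in_exact_bounds(2)[OF uv(2)] in_row_le[OF uv(2)] by blast
    then show ?thesis using kept_le(2)[OF assms(4)] by (meson max.coboundedI2 order_trans)
  qed
qed

text \<open>At an exact vertex the inner light weight is at most \<open>U / R\<close> and the degree
  at most twice the crossing light weight. Their product is linear in the crossing weight, so
  summing over vertices and levels gives a multiple of the directed cut.\<close>

lemma out_variance:
  fixes S :: "nat set"
  defines "U \<equiv> ucut n a S ({..<n} - S)"
  shows "(\<Sum>u<n. \<Sum>v<n. if v \<in> S \<and> out_exact n R c dout S (lev u v) u
      then real (light u v) * (real (dout (lev u v) u) / R) else 0) \<le> 2 * U / R\<^sup>2 * dcut n a S"
    (is "(\<Sum>u<n. \<Sum>v<n. ?f u v) \<le> _")
proof -
  let ?g = "\<lambda>u v. if u \<in> S \<and> v \<notin> S then real (light u v) else 0"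
  have "(\<Sum>v<n. if lev u v = i then ?f u v else 0) \<le> 2 * U / R\<^sup>2 * (\<Sum>v<n. if lev u v = i then ?g u v else 0)"
    if "u < n" for u i
  proof (cases "out_exact n R c dout S i u")
    case True
    let ?I = "\<Sum>v<n. if lev u v = i \<and> v \<in> S then real (light u v) else 0"
    let ?O = "\<Sum>v<n. if lev u v = i \<and> v \<notin> S then real (light u v) else 0"
    have u: "u \<in> S" using True unfolding out_exact_def by simp
    have "(\<Sum>v<n. if lev u v = i then ?f u v else 0) = ?I * (real (dout i u) / R)"
      unfolding sum_distrib_right using True by (intro sum.cong) auto
    also have "\<dots> \<le> (U / R) * (2 * ?O / R)"
      using out_exact_bounds[OF that True] R ucut_nonneg unfolding U_def
      by (intro mult_mono divide_right_mono) (auto intro: divide_nonneg_nonneg)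
    also have "\<dots> = 2 * U / R\<^sup>2 * ?O" by (simp add: power2_eq_square)
    also have "?O = (\<Sum>v<n. if lev u v = i then ?g u v else 0)"
      using u by (intro sum.cong) auto
    finally show ?thesis .
  next
    case False
    then have "(\<Sum>v<n. if lev u v = i then ?f u v else 0) = 0" by (intro sum.neutral) auto
    also have "0 \<le> 2 * U / R\<^sup>2 * (\<Sum>v<n. if lev u v = i then ?g u v else 0)"
      using ucut_nonneg unfolding U_def by (intro mult_nonneg_nonneg sum_nonneg) auto
    finally show ?thesis .
  qed
  then have "(\<Sum>i<h. \<Sum>u<n. \<Sum>v<n. if lev u v = i then ?f u v else 0)
      \<le> (\<Sum>i<h. \<Sum>u<n. 2 * U / R\<^sup>2 * (\<Sum>v<n. if lev u v = i then ?g u v else 0))"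
    by (intro sum_mono) auto
  also have "\<dots> = 2 * U / R\<^sup>2 * dcut n light S"
    unfolding sum_distrib_left[symmetric] sum_by_level dcut_def ..
  also have "\<dots> \<le> 2 * U / R\<^sup>2 * dcut n a S"
    using dcut_light ucut_nonneg unfolding U_def by (intro mult_left_mono) auto
  finally show ?thesis unfolding sum_by_level .
qed

lemma in_variance:
  fixes S :: "nat set"
  defines "U \<equiv> ucut n a S ({..<n} - S)"
  shows "(\<Sum>u<n. \<Sum>v<n. if u \<notin> S \<and> in_exact n R c din S (lev u v) v
      then real (light u v) * (real (din (lev u v) v) / R) else 0) \<le> 2 * U / R\<^sup>2 * dcut n a S"
    (is "(\<Sum>u<n. \<Sum>v<n. ?f u v) \<le> _")
proof -
  let ?g = "\<lambda>u v. if u \<in> S \<and> v \<notin> S then real (light u v) else 0"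
  have "(\<Sum>u<n. if lev u v = i then ?f u v else 0) \<le> 2 * U / R\<^sup>2 * (\<Sum>u<n. if lev u v = i then ?g u v else 0)"
    if "v < n" for v i
  proof (cases "in_exact n R c din S i v")
    case True
    let ?I = "\<Sum>u<n. if lev u v = i \<and> u \<notin> S then real (light u v) else 0"
    let ?O = "\<Sum>u<n. if lev u v = i \<and> u \<in> S then real (light u v) else 0"
    have v: "v \<notin> S" using True unfolding in_exact_def by simp
    have "(\<Sum>u<n. if lev u v = i then ?f u v else 0) = ?I * (real (din i v) / R)"
      unfolding sum_distrib_right using True by (intro sum.cong) auto
    also have "\<dots> \<le> (U / R) * (2 * ?O / R)"
      using in_exact_bounds[OF that True] R ucut_nonneg unfolding U_def
      by (intro mult_mono divide_right_mono) (auto intro: divide_nonneg_nonneg)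
    also have "\<dots> = 2 * U / R\<^sup>2 * ?O" by (simp add: power2_eq_square)
    also have "?O = (\<Sum>u<n. if lev u v = i then ?g u v else 0)"
      using v by (intro sum.cong) auto
    finally show ?thesis .
  next
    case False
    then have "(\<Sum>u<n. if lev u v = i then ?f u v else 0) = 0" by (intro sum.neutral) auto
    also have "0 \<le> 2 * U / R\<^sup>2 * (\<Sum>u<n. if lev u v = i then ?g u v else 0)"
      using ucut_nonneg unfolding U_def by (intro mult_nonneg_nonneg sum_nonneg) auto
    finally show ?thesis .
  qed
  then have "(\<Sum>i<h. \<Sum>v<n. \<Sum>u<n. if lev u v = i then ?f u v else 0)
      \<le> (\<Sum>i<h. \<Sum>v<n. 2 * U / R\<^sup>2 * (\<Sum>u<n. if lev u v = i then ?g u v else 0))"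
    by (intro sum_mono) auto
  also have "\<dots> = 2 * U / R\<^sup>2 * (\<Sum>i<h. \<Sum>v<n. \<Sum>u<n. if lev u v = i then ?g u v else 0)"
    unfolding sum_distrib_left[symmetric] ..
  also have "(\<Sum>i<h. \<Sum>v<n. \<Sum>u<n. if lev u v = i then ?g u v else 0)
      = (\<Sum>i<h. \<Sum>u<n. \<Sum>v<n. if lev u v = i then ?g u v else 0)"
    by (rule sum.cong[OF refl], rule sum.swap)
  also have "2 * U / R\<^sup>2 * \<dots> = 2 * U / R\<^sup>2 * dcut n light S"
    unfolding sum_by_level dcut_def ..
  also have "\<dots> \<le> 2 * U / R\<^sup>2 * dcut n a S"
    using dcut_light ucut_nonneg unfolding U_def by (intro mult_left_mono) auto
  also have "(\<Sum>i<h. \<Sum>v<n. \<Sum>u<n. if lev u v = i then ?f u v else 0)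
      = (\<Sum>i<h. \<Sum>u<n. \<Sum>v<n. if lev u v = i then ?f u v else 0)"
    by (rule sum.cong[OF refl], rule sum.swap)
  finally show ?thesis unfolding sum_by_level .
qed

text \<open>Each noisy edge is charged to one of three sums: crossing edges, where
  \<open>kept\<close> is at most \<open>2 * U / R\<^sup>2\<close>, inner edges with an exact tail,
  and inner edges with an exact head. Each sum is at most \<open>2 * U / R\<^sup>2\<close> times the
  cut.\<close>

lemma variance_le:
  fixes S :: "nat set"
  defines "U \<equiv> ucut n a S ({..<n} - S)"
  shows "(\<Sum>u<n. \<Sum>v<n. if coefficient n R h S c dout din u v \<noteq> 0 \<and> kept u v \<noteq> light u v
      then real (light u v) * real (kept u v) else 0) \<le> 6 * U / R\<^sup>2 * dcut n a S"
    (is "(\<Sum>u<n. \<Sum>v<n. ?f u v) \<le> _")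
proof -
  let ?e = "\<lambda>u v. (if u \<in> S \<and> v \<notin> S then real (light u v) else 0) * (2 * U / R\<^sup>2)"
  let ?o = "\<lambda>u v. if v \<in> S \<and> out_exact n R c dout S (lev u v) u
      then real (light u v) * (real (dout (lev u v) u) / R) else 0"
  let ?i = "\<lambda>u v. if u \<notin> S \<and> in_exact n R c din S (lev u v) v
      then real (light u v) * (real (din (lev u v) v) / R) else 0"
  have "?f u v \<le> ?e u v + ?o u v + ?i u v" if uv: "u < n" "v < n" for u v
  proof -
    have nonneg: "0 \<le> ?e u v" "0 \<le> ?o u v" "0 \<le> ?i u v"
      using R ucut_nonneg unfolding U_def by auto
    show ?thesis
    proof (cases "coefficient n R h S c dout din u v \<noteq> 0 \<and> kept u v \<noteq> light u v")
      case True
      have small: "x / R \<le> 2 * U / R\<^sup>2" if "x \<le> threshold n R c S (lev u v) y" for x y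
      proof -
        have "x / R \<le> (2 * U / R) / R"
          using that threshold_le[of S "lev u v" y] R unfolding U_def by (intro divide_right_mono) auto
        then show ?thesis by (simp add: power2_eq_square)
      qed
      have k: "real (kept u v) \<le> real (dout (lev u v) u) / R" "real (kept u v) \<le> real (din (lev u v) v) / R"
        using kept_le True by auto
      from coefficient_cases(2)[OF uv conjunct1[OF True]]
      have "real (light u v) * real (kept u v) \<le> ?e u v \<or> real (light u v) * real (kept u v) \<le> ?o u v
        \<or> real (light u v) * real (kept u v) \<le> ?i u v"
      proof (elim disjE conjE)
        assume "u \<in> S" "v \<notin> S" "real (dout (lev u v) u) \<le> threshold n R c S (lev u v) u"
        then have "real (light u v) * real (kept u v) \<le> ?e u v"
          using mult_left_mono[OF order_trans[OF k(1) small]] by simp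
        then show ?thesis by blast
      next
        assume "u \<in> S" "v \<notin> S" "real (din (lev u v) v) \<le> threshold n R c S (lev u v) v"
        then have "real (light u v) * real (kept u v) \<le> ?e u v"
          using mult_left_mono[OF order_trans[OF k(2) small]] by simp
        then show ?thesis by blast
      next
        assume "v \<in> S" "out_exact n R c dout S (lev u v) u"
        then have "real (light u v) * real (kept u v) \<le> ?o u v" using k(1) mult_left_mono by fastforce
        then show ?thesis by blast
      next
        assume "u \<notin> S" "in_exact n R c din S (lev u v) v"
        then have "real (light u v) * real (kept u v) \<le> ?i u v" using k(2) mult_left_mono by fastforce
        then show ?thesis by blast
      qed
      then show ?thesis using nonneg unfolding if_P[OF True] by linarith
    next
      case False
      then show ?thesis using nonneg unfolding if_not_P[OF False] by linarith
    qed
  qed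
  then have "(\<Sum>u<n. \<Sum>v<n. ?f u v) \<le> (\<Sum>u<n. \<Sum>v<n. ?e u v + ?o u v + ?i u v)"
    by (intro sum_mono) auto
  also have "\<dots> = dcut n light S * (2 * U / R\<^sup>2) + (\<Sum>u<n. \<Sum>v<n. ?o u v) + (\<Sum>u<n. \<Sum>v<n. ?i u v)"
    unfolding dcut_def sum_distrib_right by (simp only: sum.distrib)
  also have "\<dots> \<le> dcut n a S * (2 * U / R\<^sup>2) + 2 * U / R\<^sup>2 * dcut n a S + 2 * U / R\<^sup>2 * dcut n a S"
    using out_variance in_variance dcut_light ucut_nonneg unfolding U_def
    by (intro add_mono mult_right_mono) auto
  finally show ?thesis by (simp add: algebra_simps)
qed

text \<open>This bounds the expected number of samples. Up to a factor \<open>2 * R\<close>, a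
  probability is at most the light weight over the smaller of the two degrees, hence at most its
  share of the out-degree plus its share of the in-degree; the shares at one vertex and level sum to
  at most 1.\<close>

lemma sum_probabilities_le:
  "(\<Sum>u<n. \<Sum>v<n. real (light u v) / real (kept u v)) \<le> 4 * real n * R * real h"
proof -
  let ?o = "\<lambda>u v. real (light u v) / real (dout (lev u v) u)"
  let ?i = "\<lambda>u v. real (light u v) / real (din (lev u v) v)"
  have "real (light u v) / real (kept u v) \<le> 2 * R * (?o u v + ?i u v)" if uv: "u < n" "v < n" for u v
  proof (cases "light u v = 0")
    case False
    have "light u v \<le> dout (lev u v) u"
      unfolding dout_def using uv
      by (intro order_trans[OF _ member_le_sum[of v]]) auto
    moreover have "light u v \<le> din (lev u v) v"
      unfolding din_def using uv
      by (intro order_trans[OF _ member_le_sum[of u]]) auto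
    ultimately have pos: "0 < dout (lev u v) u" "0 < din (lev u v) v" using False by auto
    define m where "m = min (dout (lev u v) u) (din (lev u v) v)"
    have m: "0 < m" using pos unfolding m_def by simp
    have "1 / real m \<le> 1 / real (dout (lev u v) u) + 1 / real (din (lev u v) v)"
      unfolding m_def by (auto simp: min_def)
    then have *: "real (light u v) / real m \<le> ?o u v + ?i u v"
      using mult_left_mono[of "1 / real m" _ "real (light u v)"] by (fastforce simp: distrib_left)
    have k: "1 \<le> kept u v" using kept_ge[of u v] False by simp
    \<comment> \<open>Since \<open>kept\<close> is a positive integer, the loss of less than 1 in
      rounding down costs only a factor of two.\<close>
    have "real m / R < real (nat \<lfloor>real m / R\<rfloor>) + 1" using R by simp
    also have "nat \<lfloor>real m / R\<rfloor> \<le> kept u v" unfolding kept_def m_def by simp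
    finally have "real m / R \<le> 2 * real (kept u v)" using k by simp
    then have "real m \<le> 2 * R * real (kept u v)" using R by (simp add: field_simps)
    then have "1 / real (kept u v) \<le> 2 * R / real m" using m k by (simp add: field_simps)
    then have "real (light u v) * (1 / real (kept u v)) \<le> real (light u v) * (2 * R / real m)"
      by (intro mult_left_mono) auto
    also have "\<dots> = 2 * R * (real (light u v) / real m)" by simp
    also have "\<dots> \<le> 2 * R * (?o u v + ?i u v)" using * R by (intro mult_left_mono) auto
    finally show ?thesis by simp
  qed (use R in auto)
  then have "(\<Sum>u<n. \<Sum>v<n. real (light u v) / real (kept u v)) \<le> (\<Sum>u<n. \<Sum>v<n. 2 * R * (?o u v + ?i u v))"
    by (intro sum_mono) auto
  also have "\<dots> = 2 * R * ((\<Sum>u<n. \<Sum>v<n. ?o u v) + (\<Sum>u<n. \<Sum>v<n. ?i u v))"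
    by (simp only: sum_distrib_left sum.distrib distrib_left)
  also have "(\<Sum>u<n. \<Sum>v<n. ?o u v) \<le> real n * real h"
  proof -
    have "(\<Sum>v<n. if lev u v = i then ?o u v else 0) \<le> 1" for u i
    proof -
      have "(\<Sum>v<n. if lev u v = i then ?o u v else 0) = real (dout i u) / real (dout i u)"
        unfolding real_dout[of i u] sum_divide_distrib by (intro sum.cong) (auto simp: real_dout)
      then show ?thesis by (cases "real (dout i u) = 0") auto
    qed
    then have "(\<Sum>i<h. \<Sum>u<n. \<Sum>v<n. if lev u v = i then ?o u v else 0) \<le> (\<Sum>i<h. \<Sum>u<n. 1)"
      by (intro sum_mono)
    then show ?thesis unfolding sum_by_level by (simp add: mult.commute)
  qed
  also have "(\<Sum>u<n. \<Sum>v<n. ?i u v) \<le> real n * real h"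
  proof -
    have "(\<Sum>u<n. if lev u v = i then ?i u v else 0) \<le> 1" for v i
    proof -
      have "(\<Sum>u<n. if lev u v = i then ?i u v else 0) = real (din i v) / real (din i v)"
        unfolding real_din[of i v] sum_divide_distrib by (intro sum.cong) (auto simp: real_din)
      then show ?thesis by (cases "real (din i v) = 0") auto
    qed
    then have "(\<Sum>i<h. \<Sum>v<n. \<Sum>u<n. if lev u v = i then ?i u v else 0) \<le> (\<Sum>i<h. \<Sum>v<n. 1)"
      by (intro sum_mono)
    moreover have "(\<Sum>i<h. \<Sum>v<n. \<Sum>u<n. if lev u v = i then ?i u v else 0)
        = (\<Sum>i<h. \<Sum>u<n. \<Sum>v<n. if lev u v = i then ?i u v else 0)"
      by (rule sum.cong[OF refl], rule sum.swap)
    ultimately show ?thesis unfolding sum_by_level by (simp add: mult.commute)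
  qed
  finally show ?thesis using R by (simp add: mult_left_mono algebra_simps)
qed

text \<open>Apart from loops, which have weight 0, the edges of level \<open>i\<close> are those
  that cross at level \<open>i + 1\<close> but not at level \<open>i\<close>. Their weight is the
  increase of the crossing weight, which \<open>decrease\<close> pays for with the
  potential.\<close>

lemma level_weight_le:
  "(\<Sum>u<n. \<Sum>v<n. if lev u v = i then real (a u v) else 0)
   \<le> 2 ^ Suc i / real n * (potential n (c i) - potential n (c (Suc i)))"
proof -
  have "(if lev u v = i then real (a u v) else 0) + (if c i u \<noteq> c i v then real (a u v) else 0)
      = (if c (Suc i) u \<noteq> c (Suc i) v then real (a u v) else 0)" if uv: "u < n" "v < n" for u v
  proof (cases "u = v")
    case False
    then show ?thesis using lev_eq_iff[OF uv False, of i] nested[OF uv, of i]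
      by (cases "c i u = c i v"; cases "c (Suc i) u = c (Suc i) v") simp_all
  qed (simp add: diag)
  then have "(\<Sum>u<n. \<Sum>v<n. if lev u v = i then real (a u v) else 0) + cross_weight n a (c i)
      = cross_weight n a (c (Suc i))"
    unfolding cross_weight_def sum.distrib[symmetric] by (intro sum.cong refl) auto
  then show ?thesis using decrease[of i] by (simp only: right_diff_distrib)
qed

text \<open>A heavy edge of level \<open>i\<close> weighs more than \<open>2 ^ i / (n * R)\<close>,
  so its weight times \<open>n * R / 2 ^ i\<close> counts it at least once. On each level this sums
  to at most \<open>2 * R\<close> times the drop of the potential, and the drops telescope from the
  potential of the single class.\<close>

lemma card_heavy_le:
  "real (card {(u, v). u < n \<and> v < n \<and> heavy u v \<noteq> 0}) \<le> 2 * R * (real n * log 2 (real n))"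
proof -
  have eq: "{(u, v). u < n \<and> v < n \<and> heavy u v \<noteq> 0} = {e \<in> {..<n} \<times> {..<n}. (case e of (u, v) \<Rightarrow> heavy u v \<noteq> 0)}"
    by auto
  have "real (card {(u, v). u < n \<and> v < n \<and> heavy u v \<noteq> 0})
      = (\<Sum>u<n. \<Sum>v<n. if heavy u v \<noteq> 0 then 1 else 0)"
    unfolding sum.cartesian_product eq by (simp add: sum.If_cases Int_def case_prod_beta)
  also have "\<dots> \<le> (\<Sum>u<n. \<Sum>v<n. real (a u v) * (real n * R) / 2 ^ lev u v)"
    using R n by (intro sum_mono) (auto simp: heavy_def field_simps)
  also have "\<dots> = (\<Sum>i<h. \<Sum>u<n. \<Sum>v<n. if lev u v = i then real (a u v) * (real n * R) / 2 ^ lev u v else 0)"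
    by (rule sum_by_level[symmetric])
  also have "\<dots> = (\<Sum>i<h. real n * R / 2 ^ i * (\<Sum>u<n. \<Sum>v<n. if lev u v = i then real (a u v) else 0))"
    unfolding sum_distrib_left by (intro sum.cong refl) auto
  also have "\<dots> \<le> (\<Sum>i<h. real n * R / 2 ^ i * (2 ^ Suc i / real n * (potential n (c i) - potential n (c (Suc i)))))"
    using R by (intro sum_mono mult_left_mono level_weight_le) auto
  also have "\<dots> = (\<Sum>i<h. 2 * R * (potential n (c i) - potential n (c (Suc i))))"
    using n by (intro sum.cong) (auto simp: field_simps)
  also have "\<dots> = 2 * R * (potential n (c 0) - potential n (c h))"
    by (simp only: sum_distrib_left[symmetric] sum_lessThan_telescope'[of "\<lambda>i. potential n (c i)"])
  also have "\<dots> \<le> 2 * R * potential n (c 0)"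
    using R potential_nonneg[of n "c h"] by (intro mult_left_mono) auto
  also have "potential n (c 0) = real n * log 2 (real n)"
    unfolding potential_def class_of_def c_0 by simp
  finally show ?thesis .
qed

end

subsection \<open>Random messages\<close>

text \<open>The first coordinate tags five arrays: classes, out-degrees, in-degrees, heavy edges and
  samples. Merging them into one sparse function lets a single count measure the message.\<close>

definition pack :: "nat \<Rightarrow> nat \<Rightarrow> (nat \<Rightarrow> nat \<Rightarrow> nat) \<Rightarrow> (nat \<Rightarrow> nat \<Rightarrow> nat) \<Rightarrow> (nat \<Rightarrow> nat \<Rightarrow> nat)
    \<Rightarrow> (nat \<Rightarrow> nat \<Rightarrow> nat) \<Rightarrow> (nat \<Rightarrow> nat \<Rightarrow> nat) \<Rightarrow> nat \<times> nat \<times> nat \<Rightarrow> nat" where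
  "pack n h c dout din heavy t = (\<lambda>(k, i, v).
     if v < n then
       if k = 0 \<and> i < h then c i v
       else if k = 1 \<and> i < h then dout i v
       else if k = 2 \<and> i < h then din i v
       else if k = 3 \<and> i < n then heavy i v
       else if k = 4 \<and> i < n then t i v
       else 0
     else 0)"

definition decode :: "nat \<Rightarrow> real \<Rightarrow> nat \<Rightarrow> nat set \<Rightarrow> (nat \<times> nat \<times> nat \<Rightarrow> nat) \<Rightarrow> real" where
  "decode n R h S F = estimate n R h S (\<lambda>i v. F (0, i, v)) (\<lambda>i v. F (1, i, v)) (\<lambda>i v. F (2, i, v))
     (\<lambda>u v. F (3, u, v)) (\<lambda>u v. F (4, u, v))"

definition messages :: "nat \<Rightarrow> nat \<Rightarrow> nat \<Rightarrow> nat \<Rightarrow> (nat \<times> nat \<times> nat \<Rightarrow> nat) set" where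
  "messages n h M Q = {F. {x. F x \<noteq> 0} \<subseteq> {..<5} \<times> {..<h + n} \<times> {..<n} \<and> card {x. F x \<noteq> 0} \<le> M \<and> (\<forall>x. F x \<le> Q)}"

lemma zero_in_messages: "(\<lambda>_. 0) \<in> messages n h M Q"
  unfolding messages_def by simp

lemma decode_pack:
  assumes "0 < h"
  shows "decode n R h S (pack n h c dout din heavy t) = estimate n R h S c dout din heavy t"
  unfolding decode_def pack_def by (rule estimate_cong[OF assms]) auto

lemma pack_in_messages:
  assumes "\<And>i v. i < h \<Longrightarrow> v < n \<Longrightarrow> c i v \<le> Q" "\<And>i v. i < h \<Longrightarrow> v < n \<Longrightarrow> dout i v \<le> Q"
    "\<And>i v. i < h \<Longrightarrow> v < n \<Longrightarrow> din i v \<le> Q"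
    "\<And>u v. u < n \<Longrightarrow> v < n \<Longrightarrow> heavy u v \<le> Q" "\<And>u v. u < n \<Longrightarrow> v < n \<Longrightarrow> t u v \<le> Q"
    and M: "3 * h * n + card {(u, v). u < n \<and> v < n \<and> heavy u v \<noteq> 0}
      + card {(u, v). u < n \<and> v < n \<and> t u v \<noteq> 0} \<le> M"
  shows "pack n h c dout din heavy t \<in> messages n h M Q"
proof -
  let ?F = "pack n h c dout din heavy t"
  let ?H = "{(u, v). u < n \<and> v < n \<and> heavy u v \<noteq> 0}" and ?T = "{(u, v). u < n \<and> v < n \<and> t u v \<noteq> 0}"
  let ?A = "{..<3::nat} \<times> {..<h} \<times> {..<n}" and ?B = "Pair (3::nat) ` ?H" and ?C = "Pair (4::nat) ` ?T"
  have fin: "finite ?H" "finite ?T" by (rule finite_subset[of _ "{..<n} \<times> {..<n}"]; auto)+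
  have "{x. ?F x \<noteq> 0} \<subseteq> ?A \<union> (?B \<union> ?C)"
    unfolding pack_def by (auto split: if_splits)
  then have "card {x. ?F x \<noteq> 0} \<le> card (?A \<union> (?B \<union> ?C))" using fin by (intro card_mono) auto
  also have "\<dots> \<le> card ?A + (card ?B + card ?C)"
    using card_Un_le[of ?A "?B \<union> ?C"] card_Un_le[of ?B ?C] by linarith
  also have "\<dots> \<le> 3 * h * n + (card ?H + card ?T)"
    using fin by (simp add: card_cartesian_product card_image_le add_mono)
  finally have "card {x. ?F x \<noteq> 0} \<le> M" using M by linarith
  moreover have "{x. ?F x \<noteq> 0} \<subseteq> {..<5} \<times> {..<h + n} \<times> {..<n}"
    unfolding pack_def by (auto split: if_splits)
  moreover have "?F x \<le> Q" for x
    unfolding pack_def using assms(1-5) by (auto split: prod.split)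
  ultimately show ?thesis unfolding messages_def by blast
qed

section \<open>Sampling the light edges\<close>

context sparse_levels begin

text \<open>The three summands below \<open>M\<close> pay for the tables per level, for the heavy
  edges, and for three times the bound on the expected number of samples. The tail adds the chance
  of too many samples to a Bernstein bound with variance at most \<open>b\<^sup>2\<close>.\<close>

lemma ex_random_message:
  assumes N: "\<And>u v. a u v \<le> N" "1 \<le> N"
    and M: "3 * real h * real n + 2 * R * (real n * log 2 (real n)) + 12 * real n * R * real h \<le> real M"
  obtains p where "set_pmf p \<subseteq> messages n h M (n * N)"
    and "\<And>S b x. b > 0 \<Longrightarrow> 2 * ucut n a S ({..<n} - S) / R\<^sup>2 \<le> b \<Longrightarrow> 2 * dcut n a S / R \<le> b
       \<Longrightarrow> 6 * ucut n a S ({..<n} - S) / R\<^sup>2 * dcut n a S \<le> b\<^sup>2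
       \<Longrightarrow> measure_pmf.prob p {F. x \<le> \<bar>decode n R h S F - dcut n a S\<bar>}
           \<le> exp (- (4 * real n * R * real h)) + 2 * exp (1 - x / b)"
proof -
  define E where "E = {(u, v). u < n \<and> v < n \<and> 0 < light u v}"
  define l where "l = (\<lambda>(u, v). real (light u v))"
  define z where "z = (\<lambda>(u, v). real (kept u v))"
  define P where "P = Pi_pmf E False (\<lambda>e. bernoulli_pmf (l e / z e))"
  define t where "t = (\<lambda>y u v. if (u, v) \<in> E \<and> y (u, v) then kept u v else 0)"
  define \<mu> where "\<mu> = 4 * real n * R * real h"
  \<comment> \<open>Too many samples would break the size limit. The zero message is sent then, so
    the size bound always holds and only accuracy can fail.\<close>
  define msg where "msg = (\<lambda>y. if real (card {e \<in> E. y e}) < 3 * \<mu>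
     then pack n h c dout din heavy (t y) else (\<lambda>_. 0))"
  have finE: "finite E" unfolding E_def by (rule finite_subset[of _ "{..<n} \<times> {..<n}"]) auto
  have lz: "0 < l e \<and> l e \<le> z e" if "e \<in> E" for e
    using that kept_ge unfolding E_def l_def z_def by auto
  have sumE: "(\<Sum>u<n. \<Sum>v<n. f u v) = (\<Sum>(u, v)\<in>E. f u v)"
    if "\<And>u v. light u v = 0 \<Longrightarrow> f u v = 0" for f :: "nat \<Rightarrow> nat \<Rightarrow> real"
    unfolding sum.cartesian_product E_def by (rule sum.mono_neutral_right) (use that in auto)
  have dout_le: "dout i v \<le> n * N" for i v
    unfolding dout_def using sum_bounded_above[of "{..<n}" "\<lambda>u. if lev v u = i then light v u else 0" N]
      order_trans[OF light_le N(1)] by simp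
  have din_le: "din i v \<le> n * N" for i v
    unfolding din_def using sum_bounded_above[of "{..<n}" "\<lambda>u. if lev u v = i then light u v else 0" N]
      order_trans[OF light_le N(1)] by simp
  have N_le: "N \<le> n * N" using n by simp
  have n_le: "n \<le> n * N" using N(2) by simp
  have kept_n: "kept u v \<le> n * N" for u v
  proof (cases "kept u v = light u v")
    case True
    then show ?thesis using light_le[of u v] N(1)[of u v] N_le by linarith
  next
    case False
    have "real (kept u v) \<le> real (dout (lev u v) u) / R" using kept_le(1)[OF False] .
    also have "\<dots> \<le> real (dout (lev u v) u)" using R divide_left_mono[of 1 R "real (dout (lev u v) u)"] by simp
    finally show ?thesis using dout_le[of "lev u v" u] by linarith
  qed
  have in_messages: "msg y \<in> messages n h M (n * N)" for y
  proof (cases "real (card {e \<in> E. y e}) < 3 * \<mu>")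
    case True
    have "{(u, v). u < n \<and> v < n \<and> t y u v \<noteq> 0} \<subseteq> {e \<in> E. y e}" unfolding t_def by auto
    then have "card {(u, v). u < n \<and> v < n \<and> t y u v \<noteq> 0} \<le> card {e \<in> E. y e}"
      using finE by (intro card_mono) auto
    then have "real (3 * h * n + card {(u, v). u < n \<and> v < n \<and> heavy u v \<noteq> 0}
      + card {(u, v). u < n \<and> v < n \<and> t y u v \<noteq> 0}) \<le> real M"
      using True card_heavy_le M unfolding \<mu>_def by simp
    then have card: "3 * h * n + card {(u, v). u < n \<and> v < n \<and> heavy u v \<noteq> 0}
      + card {(u, v). u < n \<and> v < n \<and> t y u v \<noteq> 0} \<le> M" by (simp only: of_nat_le_iff)
    have "c i v \<le> n * N" if "v < n" for i v using c_less[OF that] n_le less_imp_le order_trans by blast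
    moreover have "heavy u v \<le> n * N" for u v
      using light_heavy[of u v] N(1)[of u v] N_le by linarith
    moreover have "t y u v \<le> n * N" for u v using kept_n unfolding t_def by simp
    ultimately have "pack n h c dout din heavy (t y) \<in> messages n h M (n * N)"
      using dout_le din_le card by (intro pack_in_messages) blast+
    then show ?thesis using True unfolding msg_def by simp
  qed (simp add: msg_def zero_in_messages)
  have tail: "measure_pmf.prob (map_pmf msg P) {F. x \<le> \<bar>decode n R h S F - dcut n a S\<bar>}
           \<le> exp (- (4 * real n * R * real h)) + 2 * exp (1 - x / b)"
    if b: "b > 0" "2 * ucut n a S ({..<n} - S) / R\<^sup>2 \<le> b" "2 * dcut n a S / R \<le> b"
       "6 * ucut n a S ({..<n} - S) / R\<^sup>2 * dcut n a S \<le> b\<^sup>2" for S b x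
  proof -
    define \<sigma> where "\<sigma> = (\<lambda>(u, v). coefficient n R h S c dout din u v)"
    let ?bad1 = "{y. real (card {e \<in> E. y e}) \<ge> 3 * \<mu>}"
    let ?bad2 = "{y. \<bar>\<Sum>e\<in>E. \<sigma> e * (z e * of_bool (y e) - l e)\<bar> \<ge> x}"
    have error: "decode n R h S (msg y) - dcut n a S = (\<Sum>e\<in>E. \<sigma> e * (z e * of_bool (y e) - l e))"
      if "y \<notin> ?bad1" for y
    proof -
      have "decode n R h S (msg y) - dcut n a S
        = (\<Sum>u<n. \<Sum>v<n. coefficient n R h S c dout din u v * (real (t y u v) - real (light u v)))"
        using that unfolding msg_def by (simp add: decode_pack[OF h_pos] estimate_error)
      also have "\<dots> = (\<Sum>(u, v)\<in>E. coefficient n R h S c dout din u v * (real (t y u v) - real (light u v)))"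
        by (rule sumE) (auto simp: t_def E_def)
      also have "\<dots> = (\<Sum>e\<in>E. \<sigma> e * (z e * of_bool (y e) - l e))"
        unfolding \<sigma>_def z_def l_def t_def by (intro sum.cong) auto
      finally show ?thesis .
    qed
    have "measure_pmf.prob (map_pmf msg P) {F. x \<le> \<bar>decode n R h S F - dcut n a S\<bar>}
        = measure_pmf.prob P {y. x \<le> \<bar>decode n R h S (msg y) - dcut n a S\<bar>}"
      by (simp add: vimage_def)
    also have "\<dots> \<le> measure_pmf.prob P (?bad1 \<union> ?bad2)"
    proof (rule measure_pmf.finite_measure_mono)
      show "{y. x \<le> \<bar>decode n R h S (msg y) - dcut n a S\<bar>} \<subseteq> ?bad1 \<union> ?bad2"
      proof
        fix y assume "y \<in> {y. x \<le> \<bar>decode n R h S (msg y) - dcut n a S\<bar>}"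
        then show "y \<in> ?bad1 \<union> ?bad2" using error[of y] by (cases "y \<in> ?bad1") simp_all
      qed
    qed simp
    also have "\<dots> \<le> measure_pmf.prob P ?bad1 + measure_pmf.prob P ?bad2"
      by (rule measure_Un_le) auto
    also have "measure_pmf.prob P ?bad1 \<le> exp (- \<mu>)"
    proof -
      have "(\<Sum>e\<in>E. l e / z e) = (\<Sum>u<n. \<Sum>v<n. real (light u v) / real (kept u v))"
        by (subst sumE) (auto simp: l_def z_def intro: sum.cong)
      then show ?thesis
        unfolding P_def using lz sum_probabilities_le finE
        by (intro prob_many_successes_le) (auto simp: \<mu>_def dest!: lz)
    qed
    also have "measure_pmf.prob P ?bad2 \<le> 2 * exp (b\<^sup>2 / b\<^sup>2 - x / b)"
      unfolding P_def
    proof (rule importance_sampling_tail[OF finE lz b(1)])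
      show "\<bar>\<sigma> e\<bar> \<le> 1" if "e \<in> E" for e
        using that coefficient_cases(1) unfolding \<sigma>_def E_def by auto
      show "z e \<le> b" if "e \<in> E" "\<sigma> e \<noteq> 0" "z e \<noteq> l e" for e
      proof -
        obtain u v where e: "e = (u, v)" by fastforce
        have "real (kept u v) \<le> max (2 * ucut n a S ({..<n} - S) / R\<^sup>2) (2 * dcut n a S / R)"
          using that by (intro kept_magnitude) (auto simp: e E_def \<sigma>_def z_def l_def)
        then show ?thesis using b unfolding e z_def by auto
      qed
      have "(\<Sum>e | e \<in> E \<and> \<sigma> e \<noteq> 0 \<and> z e \<noteq> l e. l e * z e)
         = (\<Sum>(u, v)\<in>E. if coefficient n R h S c dout din u v \<noteq> 0 \<and> kept u v \<noteq> light u v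
             then real (light u v) * real (kept u v) else 0)"
        using finE by (intro sum.mono_neutral_cong_left) (auto simp: \<sigma>_def z_def l_def split: if_splits)
      also have "\<dots> = (\<Sum>u<n. \<Sum>v<n. if coefficient n R h S c dout din u v \<noteq> 0 \<and> kept u v \<noteq> light u v
             then real (light u v) * real (kept u v) else 0)"
        by (rule sumE[symmetric]) auto
      also have "\<dots> \<le> b\<^sup>2" using variance_le[of S] b(4) by (rule order_trans)
      finally show "(\<Sum>e | e \<in> E \<and> \<sigma> e \<noteq> 0 \<and> z e \<noteq> l e. l e * z e) \<le> b\<^sup>2" .
    qed auto
    finally show ?thesis using b(1) unfolding \<mu>_def by simp
  qed
  show ?thesis
    by (rule that[of "map_pmf msg P"]) (use in_messages tail in auto)
qed

end

lemma ex_random_message_of_connected: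
  assumes "n \<ge> 2" "R \<ge> 1" "\<And>u. a u u = 0" and N: "\<And>u v. a u v \<le> N" "1 \<le> N"
    and conn: "\<And>S. S \<noteq> {} \<Longrightarrow> S \<subset> {..<n} \<Longrightarrow> 1 \<le> ucut n a S ({..<n} - S)"
    and h: "n * (n * n * N) < 2 ^ h"
    and M: "3 * real h * real n + 2 * R * (real n * log 2 (real n)) + 12 * real n * R * real h \<le> real M"
  obtains p where "set_pmf p \<subseteq> messages n h M (n * N)"
    and "\<And>S b x. b > 0 \<Longrightarrow> 2 * ucut n a S ({..<n} - S) / R\<^sup>2 \<le> b \<Longrightarrow> 2 * dcut n a S / R \<le> b
       \<Longrightarrow> 6 * ucut n a S ({..<n} - S) / R\<^sup>2 * dcut n a S \<le> b\<^sup>2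
       \<Longrightarrow> measure_pmf.prob p {F. x \<le> \<bar>decode n R h S F - dcut n a S\<bar>}
           \<le> exp (- (4 * real n * R * real h)) + 2 * exp (1 - x / b)"
proof -
  have "n \<ge> 1" using assms(1) by simp
  from sparse_hierarchy[OF this conn] obtain c where
    c: "\<And>i v. v < n \<Longrightarrow> c i v < n" "\<And>v. c 0 v = 0"
      "\<And>i u v. u < n \<Longrightarrow> v < n \<Longrightarrow> c (Suc i) u = c (Suc i) v \<Longrightarrow> c i u = c i v"
    and sparse: "\<And>i S v. 2 ^ i / real n * real (min (card (class_of n (c i) v \<inter> S)) (card (class_of n (c i) v - S)))
           \<le> ucut n a (class_of n (c i) v \<inter> S) (class_of n (c i) v - S)"
    and dec: "\<And>i. cross_weight n a (c (Suc i)) + 2 ^ Suc i / real n * potential n (c (Suc i))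
           \<le> cross_weight n a (c i) + 2 ^ Suc i / real n * potential n (c i)"
    by blast
  have separated: "c h u \<noteq> c h v" if uv: "u < n" "v < n" "u \<noteq> v" for u v
  proof
    assume eq: "c h u = c h v"
    \<comment> \<open>In a class with two vertices at level \<open>h\<close>, the cut around
      \<open>u\<close> would weigh at least \<open>2 ^ h / n\<close>, more than the whole graph can
      weigh by the choice of \<open>h\<close>.\<close>
    let ?C = "class_of n (c h) v"
    have "u \<in> ?C \<inter> {u}" "v \<in> ?C - {u}" using uv eq unfolding class_of_def by auto
    then have "?C \<inter> {u} \<noteq> {}" "?C - {u} \<noteq> {}" by blast+
    then have "0 < card (?C \<inter> {u})" "0 < card (?C - {u})"
      by (simp_all only: card_gt_0_iff finite_Int finite_Diff finite_class_of simp_thms)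
    then have "1 \<le> min (card (?C \<inter> {u})) (card (?C - {u}))" by simp
    then have "2 ^ h / real n * 1 \<le> 2 ^ h / real n * real (min (card (?C \<inter> {u})) (card (?C - {u})))"
      by (intro mult_left_mono) auto
    also have "\<dots> \<le> ucut n a (?C \<inter> {u}) (?C - {u})" by (rule sparse)
    also have "\<dots> \<le> (\<Sum>u<n. \<Sum>v<n. real N)"
      unfolding ucut_def using N(1) by (intro sum_mono) auto
    also have "\<dots> = real (n * n * N)" by simp
    finally have "2 ^ h \<le> real n * real (n * n * N)" using assms(1) by (simp add: field_simps)
    then have "real (2 ^ h) \<le> real (n * (n * n * N))" by simp
    then show False using h by (simp only: of_nat_le_iff)
  qed
  interpret sparse_levels n a c h R
    by unfold_locales (fact assms c sparse dec separated)+
  show ?thesis by (rule ex_random_message[OF N M]) (rule that)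
qed

subsection \<open>Rounding and balance\<close>

text \<open>Passes from abstract messages to bit strings. The encoding is injective on the support
  of the random message, so inverting it before decoding loses no success probability.\<close>

lemma sketch_of_messages:
  fixes good :: "'w \<Rightarrow> nat set \<Rightarrow> real \<Rightarrow> bool" and dec :: "nat set \<Rightarrow> 'm \<Rightarrow> real"
  assumes "finite X" "card X \<le> 2 ^ B" "real B \<le> bound"
    and "\<And>w. valid w \<Longrightarrow> \<exists>p. set_pmf p \<subseteq> X \<and>
       (\<forall>S\<subseteq>{..<n}. measure_pmf.prob p {m. good w S (dec S m)} \<ge> q)"
  shows "\<exists>(g :: 'w \<Rightarrow> bool list pmf) (f :: nat set \<Rightarrow> bool list \<Rightarrow> real). \<forall>w. valid w \<longrightarrow>
     (\<forall>x \<in> set_pmf (g w). real (length x) \<le> bound) \<and>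
     (\<forall>S\<subseteq>{..<n}. measure_pmf.prob (g w) {x. good w S (f S x)} \<ge> q)"
proof -
  obtain enc :: "'m \<Rightarrow> bool list" where enc: "inj_on enc X" "\<And>m. m \<in> X \<Longrightarrow> length (enc m) = B"
    using ex_fixed_length_encoding[OF assms(1,2)] by blast
  obtain p where p: "\<And>w. valid w \<Longrightarrow> set_pmf (p w) \<subseteq> X"
    "\<And>w S. valid w \<Longrightarrow> S \<subseteq> {..<n} \<Longrightarrow> measure_pmf.prob (p w) {m. good w S (dec S m)} \<ge> q"
    using assms(4) by metis
  define g where "g = (\<lambda>w. map_pmf enc (p w))"
  define f where "f = (\<lambda>S x. dec S (inv_into X enc x))"
  show ?thesis
  proof (intro exI[of _ g] exI[of _ f] allI impI conjI ballI)
    fix w x assume w: "valid w" and "x \<in> set_pmf (g w)"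
    then have "length x = B" using p(1)[OF w] enc(2) unfolding g_def by auto
    then show "real (length x) \<le> bound" using assms(3) by simp
  next
    fix w S assume w: "valid w" and S: "S \<subseteq> {..<n}"
    have "measure_pmf.prob (p w) {m. good w S (dec S m)} \<le> measure_pmf.prob (p w) {m. good w S (f S (enc m))}"
      using p(1)[OF w] enc(1)
      by (intro measure_pmf.finite_measure_mono_AE) (auto simp: AE_measure_pmf_iff f_def inv_into_f_f subset_iff)
    then show "measure_pmf.prob (g w) {x. good w S (f S x)} \<ge> q"
      using p(2)[OF w S] unfolding g_def by (simp add: vimage_def)
  qed
qed

section \<open>Size of the message space\<close>

lemma log2_le_ln:
  fixes x :: real
  assumes "x \<ge> 1"
  shows "log 2 x \<le> 2 * ln x"
proof -
  have "1 / 2 \<le> ln (2::real)" using ln2_ge_two_thirds by simp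
  have "ln x \<ge> 0" using assms by simp
  then have "ln x * 1 \<le> ln x * (2 * ln 2)" using \<open>1 / 2 \<le> ln 2\<close> by (intro mult_left_mono) auto
  then show ?thesis unfolding log_def by (simp add: field_simps)
qed

lemma power_le_two_power:
  assumes "1 \<le> q"
  obtains B :: nat where "q ^ M \<le> 2 ^ B" "real B \<le> real M * (2 * ln (real q) + 1)"
proof -
  define b where "b = nat \<lceil>log 2 (real q)\<rceil>"
  have l: "0 \<le> log 2 (real q)" using assms by simp
  have "real q = 2 powr log 2 (real q)" using assms by simp
  also have "\<dots> \<le> 2 powr real b" unfolding b_def using l by (intro powr_mono) auto
  also have "\<dots> = real (2 ^ b)" by (simp add: powr_realpow)
  finally have "q ^ M \<le> (2 ^ b) ^ M" by (intro power_mono) (auto simp only: of_nat_le_iff)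
  then have "q ^ M \<le> 2 ^ (M * b)" by (simp only: power_mult[symmetric] mult.commute)
  moreover have "real b \<le> 2 * ln (real q) + 1"
    unfolding b_def using l log2_le_ln[of "real q"] assms by linarith
  then have "real (M * b) \<le> real M * (2 * ln (real q) + 1)" by (simp add: mult_left_mono)
  ultimately show ?thesis using that by blast
qed

lemma card_messages_le:
  "finite (messages n h M Q)" "card (messages n h M Q) \<le> (5 * (h + n) * n * Q + 1) ^ M"
proof -
  have "card ({..<5::nat} \<times> {..<h + n} \<times> {..<n}) = 5 * (h + n) * n"
    by (simp add: card_cartesian_product)
  with card_sparse_functions_le[where X = "{..<5::nat} \<times> {..<h + n} \<times> {..<n}" and Q = Q and M = M]
  have "finite (messages n h M Q) \<and> card (messages n h M Q) \<le> (5 * (h + n) * n * Q + 1) ^ M"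
    unfolding messages_def by (simp only: finite_lessThan finite_cartesian_product)
  then show "finite (messages n h M Q)" "card (messages n h M Q) \<le> (5 * (h + n) * n * Q + 1) ^ M"
    by blast+
qed

section \<open>Rounded weights and their cuts\<close>

lemma cutw_eq:
  assumes "S \<subseteq> {..<n}"
  shows "cutw w S ({..<n} - S) = (\<Sum>u<n. \<Sum>v<n. if u \<in> S \<and> v \<notin> S then w u v else 0)"
proof -
  have "(\<Sum>u<n. \<Sum>v<n. if u \<in> S \<and> v \<notin> S then w u v else 0)
     = (\<Sum>u\<in>S. \<Sum>v<n. if u \<in> S \<and> v \<notin> S then w u v else 0)"
    using assms by (intro sum.mono_neutral_right) (auto intro: sum.neutral)
  also have "\<dots> = (\<Sum>u\<in>S. \<Sum>v\<in>{..<n} - S. w u v)"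
    by (intro sum.cong refl sum.mono_neutral_cong_right) auto
  finally show ?thesis unfolding cutw_def by simp
qed

lemma crossing_edge:
  assumes "(s, t) \<in> r\<^sup>*" "s \<in> S" "t \<notin> S"
  obtains u v where "(u, v) \<in> r" "u \<in> S" "v \<notin> S"
  using assms by (induction rule: rtrancl_induct) auto

text \<open>Rounding up turns every non-loop edge into a positive integer, so connectivity survives.
  Loops are dropped because they cross no cut.\<close>

definition scaled :: "real \<Rightarrow> (nat \<Rightarrow> nat \<Rightarrow> real) \<Rightarrow> nat \<Rightarrow> nat \<Rightarrow> nat" where
  "scaled \<delta> w u v = (if u = v then 0 else nat \<lceil>w u v / \<delta>\<rceil>)"

text \<open>Rounding adds at most \<open>\<delta>\<close>, and nonzero weights are at least 1, so
  the relative error is at most \<open>\<delta>\<close>.\<close>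

lemma scaled_bounds:
  assumes "weights_ok n k w" "0 < \<delta>" "u \<noteq> v"
  shows "w u v \<le> \<delta> * real (scaled \<delta> w u v)" "\<delta> * real (scaled \<delta> w u v) \<le> (1 + \<delta>) * w u v"
proof -
  have w: "w u v = 0 \<or> 1 \<le> w u v" using assms(1) unfolding weights_ok_def by auto
  then have "0 \<le> w u v / \<delta>" using assms(2) by auto
  then have r: "real (scaled \<delta> w u v) = of_int \<lceil>w u v / \<delta>\<rceil>"
    unfolding scaled_def using assms(3) by simp
  have "w u v / \<delta> \<le> real (scaled \<delta> w u v)" unfolding r by simp
  then show "w u v \<le> \<delta> * real (scaled \<delta> w u v)" using assms(2) by (simp add: field_simps)
  show "\<delta> * real (scaled \<delta> w u v) \<le> (1 + \<delta>) * w u v"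
  proof (cases "w u v = 0")
    case False
    have "real (scaled \<delta> w u v) \<le> w u v / \<delta> + 1" unfolding r by linarith
    then have "\<delta> * real (scaled \<delta> w u v) \<le> \<delta> * (w u v / \<delta> + 1)" using assms(2) by (intro mult_left_mono) auto
    also have "\<dots> = w u v + \<delta> * 1" using assms(2) by (simp add: field_simps)
    also have "\<dots> \<le> w u v + \<delta> * w u v" using w False assms(2) by (intro add_left_mono mult_left_mono) auto
    finally show ?thesis by (simp add: algebra_simps)
  qed (simp add: scaled_def)
qed

lemma scaled_le:
  assumes "weights_ok n k w" "0 < \<delta>" "real n ^ k / \<delta> \<le> real N"
  shows "scaled \<delta> w u v \<le> N"
proof (cases "w u v = 0 \<or> u = v")
  case False
  then have "w u v \<le> real n ^ k" using assms(1) unfolding weights_ok_def by auto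
  then have "w u v / \<delta> \<le> real N" using assms(2,3) by (meson divide_right_mono less_imp_le order_trans)
  then show ?thesis unfolding scaled_def using False by (simp add: nat_le_iff ceiling_le_iff)
qed (auto simp: scaled_def)

lemma scaled_dcut:
  assumes "weights_ok n k w" "0 < \<delta>" "S \<subseteq> {..<n}"
  shows "cutw w S ({..<n} - S) \<le> \<delta> * dcut n (scaled \<delta> w) S"
    "\<delta> * dcut n (scaled \<delta> w) S \<le> (1 + \<delta>) * cutw w S ({..<n} - S)"
proof -
  let ?f = "\<lambda>u v. if u \<in> S \<and> v \<notin> S then \<delta> * real (scaled \<delta> w u v) else 0"
  have eq: "\<delta> * dcut n (scaled \<delta> w) S = (\<Sum>u<n. \<Sum>v<n. ?f u v)"
    unfolding dcut_def sum_distrib_left by (intro sum.cong) auto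
  show "cutw w S ({..<n} - S) \<le> \<delta> * dcut n (scaled \<delta> w) S"
    unfolding eq cutw_eq[OF assms(3)]
  proof (intro sum_mono)
    fix u v
    show "(if u \<in> S \<and> v \<notin> S then w u v else 0) \<le> ?f u v"
      using scaled_bounds(1)[OF assms(1,2), of u v] by (cases "u = v") auto
  qed
  show "\<delta> * dcut n (scaled \<delta> w) S \<le> (1 + \<delta>) * cutw w S ({..<n} - S)"
    unfolding eq cutw_eq[OF assms(3)] sum_distrib_left
  proof (intro sum_mono)
    fix u v
    show "?f u v \<le> (1 + \<delta>) * (if u \<in> S \<and> v \<notin> S then w u v else 0)"
      using scaled_bounds(2)[OF assms(1,2), of u v] by (cases "u = v") auto
  qed
qed

lemma ucut_eq_dcut:
  "ucut n a S ({..<n} - S) = dcut n a S + dcut n a ({..<n} - S)"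
  unfolding ucut_def dcut_def sum.distrib[symmetric] by (intro sum.cong) auto

lemma dcut_scaled_ge_1:
  assumes "balanced n \<beta> w" "weights_ok n k w" "0 < \<delta>" "S \<noteq> {}" "S \<subset> {..<n}"
  shows "1 \<le> dcut n (scaled \<delta> w) S"
proof -
  obtain s t where st: "s \<in> S" "t \<notin> S" "s < n" "t < n" using assms(4,5) by blast
  then have "(s, t) \<in> (edge_rel n w)\<^sup>*" using assms(1) unfolding balanced_def strongly_connected_def by blast
  then obtain u v where uv: "(u, v) \<in> edge_rel n w" "u \<in> S" "v \<notin> S" using crossing_edge st by metis
  then have uv': "u < n" "v < n" "w u v > 0" unfolding edge_rel_def by auto
  have "0 < \<delta> * real (scaled \<delta> w u v)"
    using scaled_bounds(1)[OF assms(2,3), of u v] uv uv' by fastforce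
  then have "1 \<le> real (scaled \<delta> w u v)" using assms(3) by (simp add: zero_less_mult_iff Suc_le_eq)
  also have "\<dots> = (if u \<in> S \<and> v \<notin> S then real (scaled \<delta> w u v) else 0)" using uv by simp
  also have "\<dots> \<le> (\<Sum>v<n. if u \<in> S \<and> v \<notin> S then real (scaled \<delta> w u v) else 0)"
    using uv' by (intro member_le_sum) auto
  also have "\<dots> \<le> dcut n (scaled \<delta> w) S"
    unfolding dcut_def using uv'
    by (intro member_le_sum[where f = "\<lambda>u. \<Sum>v<n. if u \<in> S \<and> v \<notin> S then real (scaled \<delta> w u v) else 0"] sum_nonneg) auto
  finally show ?thesis .
qed

text \<open>The undirected cut is the sum of both directions. Rounding costs a factor 1 + \<delta>
  \<le> 2, and balance bounds the reverse direction by \<beta> times the forward one; as \<beta>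
  \<ge> 1, the total factor is 2 * 2 * \<beta>.\<close>

lemma scaled_balanced:
  assumes "balanced n \<beta> w" "weights_ok n k w" "0 < \<delta>" "\<delta> \<le> 1 / 4" "S \<noteq> {}" "S \<subset> {..<n}"
  shows "ucut n (scaled \<delta> w) S ({..<n} - S) \<le> 4 * \<beta> * dcut n (scaled \<delta> w) S"
proof -
  let ?T = "{..<n} - S" and ?D = "cutw w S ({..<n} - S)"
  have S: "S \<subseteq> {..<n}" "{..<n} - ?T = S" using assms(6) by auto
  have \<beta>: "\<beta> \<ge> 1" using assms(1) unfolding balanced_def by blast
  have "?T \<noteq> {}" "?T \<subset> {..<n}" using assms(5,6) by auto
  then have bal: "cutw w ?T ({..<n} - ?T) \<le> \<beta> * ?D"
    using assms(1) S(2) unfolding balanced_def by metis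
  have D: "?D \<le> \<delta> * dcut n (scaled \<delta> w) S" by (rule scaled_dcut(1)[OF assms(2,3) S(1)])
  have D0: "0 \<le> ?D"
    unfolding cutw_eq[OF S(1)] using assms(2) unfolding weights_ok_def
    by (intro sum_nonneg) (smt (verit))
  have "\<delta> * ucut n (scaled \<delta> w) S ?T = \<delta> * dcut n (scaled \<delta> w) S + \<delta> * dcut n (scaled \<delta> w) ?T"
    unfolding ucut_eq_dcut by (simp add: distrib_left)
  also have "\<dots> \<le> (1 + \<delta>) * ?D + (1 + \<delta>) * cutw w ?T ({..<n} - ?T)"
    using S(1) by (intro add_mono scaled_dcut(2)[OF assms(2,3)]) auto
  also have "\<dots> = (1 + \<delta>) * (?D + cutw w ?T ({..<n} - ?T))" by (simp add: distrib_left)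
  also have "\<dots> \<le> 2 * (\<beta> * ?D + \<beta> * ?D)"
  proof (intro mult_mono add_mono bal)
    show "?D \<le> \<beta> * ?D" using mult_right_mono[OF \<beta> D0] by simp
    show "0 \<le> ?D + cutw w ?T ({..<n} - ?T)"
      using D0 unfolding cutw_eq[OF Diff_subset] using assms(2) unfolding weights_ok_def
      by (intro add_nonneg_nonneg sum_nonneg) (smt (verit))+
  qed (use assms(4) in auto)
  also have "\<dots> = 4 * \<beta> * ?D" by simp
  also have "\<dots> \<le> 4 * \<beta> * (\<delta> * dcut n (scaled \<delta> w) S)" using D \<beta> by (intro mult_left_mono) auto
  finally have "\<delta> * ucut n (scaled \<delta> w) S ?T \<le> \<delta> * (4 * \<beta> * dcut n (scaled \<delta> w) S)" by (simp add: mult_ac)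
  then show ?thesis using assms(3) by simp
qed

text \<open>Here \<open>D\<close> is the true cut, \<open>\<epsilon> / 4 * d\<close> its rounded
  value and \<open>\<epsilon> / 4 * x\<close> the estimate. From above, two relative errors of
  \<epsilon>/4 combine to (1 + \<epsilon>/4)^2 \<le> 1 + \<epsilon>; from below only the estimator
  errs, since rounding goes up.\<close>

lemma relative_error:
  fixes D d x \<epsilon> :: real
  assumes "0 < \<epsilon>" "\<epsilon> < 1" "0 \<le> D" and d: "D \<le> \<epsilon> / 4 * d" "\<epsilon> / 4 * d \<le> (1 + \<epsilon> / 4) * D"
    and x: "\<bar>x - d\<bar> \<le> \<epsilon> / 4 * d"
  shows "(1 - \<epsilon>) * D \<le> \<epsilon> / 4 * x" "\<epsilon> / 4 * x \<le> (1 + \<epsilon>) * D"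
proof -
  define y where "y = \<epsilon> / 4 * d"
  have y: "D \<le> y" "y \<le> (1 + \<epsilon> / 4) * D" using d unfolding y_def by auto
  have "\<epsilon> / 4 * x - y = \<epsilon> / 4 * (x - d)" unfolding y_def by (simp only: right_diff_distrib)
  then have "\<bar>\<epsilon> / 4 * x - y\<bar> = \<epsilon> / 4 * \<bar>x - d\<bar>" using assms(1) by (simp only: abs_mult)
  also have "\<dots> \<le> \<epsilon> / 4 * y" unfolding y_def using x assms(1) by (intro mult_left_mono) auto
  finally have xy: "\<bar>\<epsilon> / 4 * x - y\<bar> \<le> \<epsilon> / 4 * y" .
  have xy': "(1 - \<epsilon> / 4) * y \<le> \<epsilon> / 4 * x" "\<epsilon> / 4 * x \<le> (1 + \<epsilon> / 4) * y"
    using xy unfolding left_diff_distrib distrib_right abs_le_iff by linarith+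
  have "(1 - \<epsilon>) * D \<le> (1 - \<epsilon> / 4) * D" using assms by (intro mult_right_mono) auto
  also have "\<dots> \<le> (1 - \<epsilon> / 4) * y" using y assms by (intro mult_left_mono) auto
  also have "\<dots> \<le> \<epsilon> / 4 * x" by (rule xy'(1))
  finally show "(1 - \<epsilon>) * D \<le> \<epsilon> / 4 * x" .
  have "\<epsilon> / 4 * x \<le> (1 + \<epsilon> / 4) * y" by (rule xy'(2))
  also have "\<dots> \<le> (1 + \<epsilon> / 4) * ((1 + \<epsilon> / 4) * D)" using y assms by (intro mult_left_mono) auto
  also have "\<dots> = (1 + \<epsilon> / 2 + \<epsilon> * \<epsilon> / 16) * D" by (simp add: field_simps)
  also have "\<dots> \<le> (1 + \<epsilon>) * D"
  proof (intro mult_right_mono assms(3))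
    have "\<epsilon> * \<epsilon> \<le> \<epsilon> * 1" using assms by (intro mult_left_mono) auto
    then show "1 + \<epsilon> / 2 + \<epsilon> * \<epsilon> / 16 \<le> 1 + \<epsilon>" using assms(1) by linarith
  qed
  finally show "\<epsilon> / 4 * x \<le> (1 + \<epsilon>) * D" .
qed

subsection \<open>Parameters\<close>

text \<open>The size is a parameter so that the two ranges of \<epsilon> can be settled with
  different constants and joined by monotonicity.\<close>

definition has_sketch :: "nat \<Rightarrow> nat \<Rightarrow> nat \<Rightarrow> real \<Rightarrow> real \<Rightarrow> real \<Rightarrow> bool" where
  "has_sketch n k c \<beta> \<epsilon> bound \<longleftrightarrow>
     (\<exists>(g :: (nat \<Rightarrow> nat \<Rightarrow> real) \<Rightarrow> bool list pmf) (f :: nat set \<Rightarrow> bool list \<Rightarrow> real).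
       \<forall>w. balanced n \<beta> w \<and> weights_ok n k w \<longrightarrow>
         (\<forall>x \<in> set_pmf (g w). real (length x) \<le> bound) \<and>
         (\<forall>S \<subseteq> {..<n}. measure_pmf.prob (g w)
              {x. (1 - \<epsilon>) * cutw w S ({..<n} - S) \<le> f S x \<and>
                  f S x \<le> (1 + \<epsilon>) * cutw w S ({..<n} - S)}
            \<ge> 1 - 1 / real n ^ c))"

lemma cutw_nonneg: "weights_ok n k w \<Longrightarrow> S \<subseteq> {..<n} \<Longrightarrow> 0 \<le> cutw w S ({..<n} - S)"
  unfolding cutw_def weights_ok_def by (intro sum_nonneg) (smt (verit))

lemma half_le_ln: "n \<ge> 2 \<Longrightarrow> 1 / 2 \<le> ln (real n)"
proof -
  assume "n \<ge> 2"
  then have "ln 2 \<le> ln (real n)" by simp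
  then show ?thesis using ln2_ge_two_thirds by simp
qed

lemma ln_cube_ge:
  assumes "1 / 2 \<le> (L :: real)"
  shows "1 \<le> 8 * L ^ 3" "L \<le> 4 * L ^ 3"
proof -
  have "(1 / 2) ^ 3 \<le> L ^ 3" using assms by (intro power_mono) auto
  then show "1 \<le> 8 * L ^ 3" by (simp add: power3_eq_cube)
  have "(1 / 2) ^ 2 \<le> L ^ 2" using assms by (intro power_mono) auto
  then have "L * 1 \<le> L * (4 * L ^ 2)" using assms by (intro mult_left_mono) (auto simp: power2_eq_square)
  then show "L \<le> 4 * L ^ 3" by (simp add: power2_eq_square power3_eq_cube)
qed

text \<open>Below \<open>\<epsilon> = 1 / n\<^sup>2\<close> the budget suffices to store all rounded weights.\<close>
lemma has_sketch_small_eps: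
  fixes n k c :: nat
  assumes n: "n \<ge> 2" and \<beta>: "\<beta> \<ge> 1" and \<epsilon>: "0 < \<epsilon>" "\<epsilon> < 1" and small: "\<epsilon> < 1 / (real n)\<^sup>2"
  shows "has_sketch n k c \<beta> \<epsilon> (real (456 + 8 * k) * real n * sqrt \<beta> * (ln (real n)) ^ 3 / \<epsilon>)"
proof -
  define y L where "y = 1 / \<epsilon>" and "L = ln (real n)"
  define N where "N = nat \<lceil>real n ^ k / (\<epsilon> / 4)\<rceil>"
  define q where "q = 5 * (0 + n) * n * N + 1"
  define dec where "dec = (\<lambda>S (F :: nat \<times> nat \<times> nat \<Rightarrow> nat). \<epsilon> / 4 * dcut n (\<lambda>u v. F (3, u, v)) S)"
  obtain B where B: "q ^ (n * n) \<le> 2 ^ B" "real B \<le> real (n * n) * (2 * ln (real q) + 1)"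
    using power_le_two_power[of q "n * n"] unfolding q_def by auto
  have y: "(real n)\<^sup>2 < y" using small \<epsilon> n unfolding y_def by (simp add: field_simps)
  have y1: "1 < y" using \<epsilon> unfolding y_def by simp
  have nk: "1 \<le> real n ^ k" using n by simp
  have N: "real N \<le> 5 * (real n ^ k * y)"
  proof -
    have "1 * 1 \<le> real n ^ k * y" using nk y1 by (intro mult_mono) auto
    moreover have "real n ^ k / (\<epsilon> / 4) = 4 * (real n ^ k * y)" unfolding y_def by simp
    ultimately show ?thesis unfolding N_def by linarith
  qed
  have "real q = 5 * (real n * real n) * real N + 1" unfolding q_def by simp
  also have "\<dots> \<le> 5 * (real n * real n) * (5 * (real n ^ k * y)) + 1"
    using N by (intro add_right_mono mult_left_mono) auto
  also have "\<dots> \<le> 25 * (real n ^ (k + 2) * y) + 1 * (real n ^ (k + 2) * y)"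
  proof -
    have "1 * 1 \<le> real n ^ (k + 2) * y" using n y1 by (intro mult_mono one_le_power) auto
    then show ?thesis by (simp add: power_add power2_eq_square mult_ac)
  qed
  finally have "real q \<le> 26 * real n ^ (k + 2) * y" by (simp add: mult_ac)
  moreover have "1 \<le> real q" unfolding q_def by simp
  ultimately have "ln (real q) \<le> ln (26 * real n ^ (k + 2) * y)" by (subst ln_le_cancel_iff) linarith+
  also have "\<dots> = ln 26 + real (k + 2) * L + ln y"
    using n y1 unfolding L_def by (simp add: ln_mult ln_realpow algebra_simps)
  finally have lnq: "ln (real q) \<le> 25 + real (k + 2) * L + ln y" using ln_le_minus_one[of 26] by simp
  have L: "1 / 2 \<le> L" unfolding L_def by (rule half_le_ln[OF n])
  have sy: "real n \<le> sqrt y" "sqrt y * sqrt y = y" using y y1 by (auto intro: real_le_rsqrt)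
  have nn: "real n * real n \<le> real n * y"
    using y n by (intro mult_left_mono) (auto simp: power2_eq_square intro: order_trans[of _ "real n * real n"])
  have ny: "0 \<le> real n * y" using y1 by simp
  \<comment> \<open>\<open>ln y\<close> is not bounded in terms of \<open>ln n\<close> here. Instead
    \<open>ln y \<le> 2 * sqrt y\<close> and \<open>n \<le> sqrt y\<close> turn
    \<open>n * n * ln y\<close> into at most \<open>2 * (n * y)\<close>.\<close>
  have lny: "ln y \<le> 2 * sqrt y"
    using ln_le_minus_one[of "sqrt y"] y1 by (simp add: ln_sqrt)
  have "real n * real n * ln y \<le> real n * real n * (2 * sqrt y)" using lny by (intro mult_left_mono) auto
  also have "\<dots> = real n * (2 * (real n * sqrt y))" by simp
  also have "\<dots> \<le> real n * (2 * (sqrt y * sqrt y))" using sy y1 by (intro mult_left_mono mult_right_mono) auto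
  finally have nlny: "real n * real n * ln y \<le> 2 * (real n * y)" using sy by simp
  have "real B \<le> real n * real n * (2 * (25 + real (k + 2) * L + ln y) + 1)"
    using B(2) lnq by (simp add: order_trans[OF _ mult_left_mono])
  also have "\<dots> = real n * real n * (51 + 2 * real (k + 2) * L) + 2 * (real n * real n * ln y)"
    by (simp add: algebra_simps)
  also have "\<dots> \<le> real n * y * (51 + 2 * real (k + 2) * L) + 2 * (2 * (real n * y))"
  proof (intro add_mono mult_right_mono nn)
    show "2 * (real n * real n * ln y) \<le> 2 * (2 * (real n * y))" using nlny by linarith
  qed (use L in simp)
  also have "\<dots> = real n * y * (55 * 1 + 2 * real (k + 2) * L)" by (simp add: algebra_simps)
  also have "\<dots> \<le> real n * y * (55 * (8 * L ^ 3) + 2 * real (k + 2) * (4 * L ^ 3))"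
    using ln_cube_ge[OF L] ny by (intro mult_left_mono add_mono) auto
  \<comment> \<open>55 * 8 + 2 * (k + 2) * 4 = 456 + 8 * k.\<close>
  also have "\<dots> = real (456 + 8 * k) * (real n * y * L ^ 3 * 1)" by (simp add: algebra_simps)
  also have "\<dots> \<le> real (456 + 8 * k) * (real n * y * L ^ 3 * sqrt \<beta>)"
    using \<beta> L y1 by (intro mult_left_mono) auto
  also have "\<dots> = real (456 + 8 * k) * real n * sqrt \<beta> * (ln (real n)) ^ 3 / \<epsilon>"
    unfolding y_def L_def by simp
  finally have bound: "real B \<le> real (456 + 8 * k) * real n * sqrt \<beta> * (ln (real n)) ^ 3 / \<epsilon>" .
  have messages_exist: "\<exists>p. set_pmf p \<subseteq> messages n 0 (n * n) N \<and> (\<forall>S\<subseteq>{..<n}. measure_pmf.prob p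
      {m. (1 - \<epsilon>) * cutw w S ({..<n} - S) \<le> dec S m \<and> dec S m \<le> (1 + \<epsilon>) * cutw w S ({..<n} - S)}
      \<ge> 1 - 1 / real n ^ c)" if w: "balanced n \<beta> w \<and> weights_ok n k w" for w
  proof -
    \<comment> \<open>With 0 levels no tables are stored; all rounded weights go into the heavy slot
      and the message is deterministic.\<close>
    define F where "F = pack n 0 (\<lambda>_ _. 0) (\<lambda>_ _. 0) (\<lambda>_ _. 0) (scaled (\<epsilon> / 4) w) (\<lambda>_ _. 0)"
    have "scaled (\<epsilon> / 4) w u v \<le> N" for u v
      using w \<epsilon> unfolding N_def by (intro scaled_le[of n k]) (auto simp: le_nat_iff intro: of_nat_ceiling)
    moreover have "card {(u, v). u < n \<and> v < n \<and> scaled (\<epsilon> / 4) w u v \<noteq> 0} \<le> n * n"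
      using card_mono[of "{..<n} \<times> {..<n}" "{(u, v). u < n \<and> v < n \<and> scaled (\<epsilon> / 4) w u v \<noteq> 0}"]
      by (auto simp: card_cartesian_product)
    ultimately have "F \<in> messages n 0 (n * n) N" unfolding F_def by (intro pack_in_messages) auto
    moreover have "(1 - \<epsilon>) * cutw w S ({..<n} - S) \<le> dec S F \<and> dec S F \<le> (1 + \<epsilon>) * cutw w S ({..<n} - S)"
      if S: "S \<subseteq> {..<n}" for S
    proof -
      have "dcut n (\<lambda>u v. F (3, u, v)) S = dcut n (scaled (\<epsilon> / 4) w) S"
        unfolding dcut_def F_def pack_def by (intro sum.cong) auto
      moreover have "0 \<le> dcut n (scaled (\<epsilon> / 4) w) S" unfolding dcut_def by (intro sum_nonneg) auto
      ultimately show ?thesis unfolding dec_def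
        using relative_error[of \<epsilon> "cutw w S ({..<n} - S)" "dcut n (scaled (\<epsilon> / 4) w) S" "dcut n (scaled (\<epsilon> / 4) w) S"]
          scaled_dcut[of n k w "\<epsilon> / 4" S] cutw_nonneg[of n k w S] w \<epsilon> S by auto
    qed
    ultimately show ?thesis by (intro exI[of _ "return_pmf F"]) auto
  qed
  have card: "card (messages n 0 (n * n) N) \<le> 2 ^ B"
    using card_messages_le(2)[of n 0 "n * n" N] B(1) unfolding q_def by (rule order_trans)
  show ?thesis
    unfolding has_sketch_def
    by (rule sketch_of_messages[where valid = "\<lambda>w. balanced n \<beta> w \<and> weights_ok n k w" and
          good = "\<lambda>w S x. (1 - \<epsilon>) * cutw w S ({..<n} - S) \<le> x \<and> x \<le> (1 + \<epsilon>) * cutw w S ({..<n} - S)",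
        OF card_messages_le(1) card bound messages_exist])
qed


text \<open>Here 1 / \<epsilon> is polynomial in \<open>n\<close>, so every stored entry takes O(log
  n) bits. There are O(log n) levels, hence O(n R log n) entries, and \<open>R\<close> itself
  carries one logarithm; together they give the cube.\<close>

lemma has_sketch_large_eps:
  fixes n k c :: nat
  defines "K \<equiv> real (4 * (k + 8))"
  assumes n: "n \<ge> 2" and \<beta>: "\<beta> \<ge> 1" and \<epsilon>: "0 < \<epsilon>" "\<epsilon> < 1" and large: "1 / (real n)\<^sup>2 \<le> \<epsilon>"
  shows "has_sketch n k c \<beta> \<epsilon> (32 * real (c + 4) * (15 * K + 6) * (20 * K + 2 * real k + 36)
    * real n * sqrt \<beta> * (ln (real n)) ^ 3 / \<epsilon>)"
proof -
  define L where "L = ln (real n)"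
  \<comment> \<open>The factor 32 makes the exponent \<open>x / b\<close> below equal to
    \<open>(c + 4) * L\<close>; the extra 4 later beats the constant factors.\<close>
  define l where "l = 32 * (real (c + 4) * L)"
  define R where "R = sqrt \<beta> * l / \<epsilon>"
  define N where "N = n ^ (k + 4)"
  have L: "1 / 2 \<le> L" unfolding L_def by (rule half_le_ln[OF n])
  have L_n: "L \<le> real n" unfolding L_def using ln_le_minus_one[of "real n"] n by simp
  have K: "K \<ge> 1" unfolding K_def by simp
  have l1: "1 \<le> l"
  proof -
    have "4 * (1 / 2) \<le> real (c + 4) * L" using L by (intro mult_mono) auto
    then show ?thesis unfolding l_def by simp
  qed
  have sb: "1 \<le> sqrt \<beta>" "sqrt \<beta> * sqrt \<beta> = \<beta>" using \<beta> by auto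
  have l_R: "l \<le> R"
  proof -
    have "1 * l * 1 \<le> sqrt \<beta> * l * (1 / \<epsilon>)" using sb l1 \<epsilon> by (intro mult_mono) auto
    then show ?thesis unfolding R_def by simp
  qed
  have R: "1 \<le> R" using l_R l1 by simp
  \<comment> \<open>\<open>2 ^ h\<close> has to exceed \<open>n * (n * n * N) = n ^ (k + 7)\<close>
    so that the last partition separates all vertices.\<close>
  obtain h where h: "n ^ (k + 8) \<le> 2 ^ h" "real h \<le> real (k + 8) * (2 * ln (real n) + 1)"
    using power_le_two_power[of n "k + 8"] n by auto
  have "real h \<le> real (k + 8) * (2 * L + 2 * L)"
    using L by (intro order_trans[OF h(2)] mult_left_mono) (auto simp: L_def)
  then have hK: "real h \<le> K * L" unfolding K_def by (simp add: algebra_simps)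
  have "n * (n * n * N) = n ^ (k + 7)" unfolding N_def by (simp add: power_add power2_eq_square eval_nat_numeral)
  also have "\<dots> < n ^ (k + 8)" using n by (intro power_strict_increasing) auto
  finally have h_large: "n * (n * n * N) < 2 ^ h" using h(1) by simp
  have h1: "1 \<le> h" using h_large n unfolding N_def by (cases h) auto
  define X where "X = 3 * real h * real n + 2 * R * (real n * log 2 (real n)) + 12 * real n * R * real h"
  define M where "M = nat \<lceil>X\<rceil>"
  define Q where "Q = n * N"
  define q where "q = 5 * (h + n) * n * Q + 1"
  obtain B where B: "q ^ M \<le> 2 ^ B" "real B \<le> real M * (2 * ln (real q) + 1)"
    using power_le_two_power[of q M] unfolding q_def by auto
  have X_M: "X \<le> real M" unfolding M_def by linarith
  have M_le: "real M \<le> (15 * K + 6) * (real n * R * L)"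
  proof -
    have nR: "0 \<le> real n * R" "real n * 1 \<le> real n * R" by (use R in simp) (use R in \<open>intro mult_left_mono, auto\<close>)
    have "real h * real n \<le> (K * L) * (real n * R)" using hK nR K L by (intro mult_mono) auto
    moreover have "2 * R * (real n * log 2 (real n)) \<le> 2 * R * (real n * (2 * L))"
      unfolding L_def using R n by (intro mult_left_mono log2_le_ln) auto
    moreover have "12 * real n * R * real h \<le> 12 * real n * R * (K * L)"
      using hK R by (intro mult_left_mono) auto
    moreover have "1 \<le> real n * R" using nR(2) n by linarith
    then have "1 * 1 \<le> (real n * R) * (2 * L)" using L nR(1) by (intro mult_mono) auto
    moreover have "0 \<le> X" unfolding X_def using R n by (intro add_nonneg_nonneg mult_nonneg_nonneg) auto
    then have "real M \<le> X + 1" unfolding M_def by linarith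
    ultimately show ?thesis unfolding X_def by (simp add: algebra_simps)
  qed
  have lnq: "2 * ln (real q) + 1 \<le> (20 * K + 2 * real k + 36) * L"
  proof -
    have nk: "1 \<le> real n ^ (k + 7)" using n by (intro one_le_power) auto
    have "real h + real n \<le> (K + 1) * real n"
    proof -
      have "K * L \<le> K * real n" using L_n K by (intro mult_left_mono) auto
      then show ?thesis using hK unfolding distrib_right by linarith
    qed
    then have "5 * (real h + real n) * (real n * real Q) \<le> 5 * ((K + 1) * real n) * (real n * real Q)"
      by (intro mult_right_mono mult_left_mono) auto
    also have "\<dots> = 5 * (K + 1) * real n ^ (k + 7)"
      unfolding Q_def N_def by (simp add: power_add eval_nat_numeral)
    finally have "real q \<le> 5 * (K + 1) * real n ^ (k + 7) + 1 * real n ^ (k + 7)"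
      using nk unfolding q_def by (simp add: mult.assoc)
    also have "\<dots> = (5 * K + 6) * real n ^ (k + 7)" by (simp add: algebra_simps)
    finally have "real q \<le> (5 * K + 6) * real n ^ (k + 7)" .
    moreover have "1 \<le> real q" unfolding q_def by simp
    ultimately have "ln (real q) \<le> ln ((5 * K + 6) * real n ^ (k + 7))" by (subst ln_le_cancel_iff) linarith+
    also have "\<dots> = ln (5 * K + 6) + real (k + 7) * L"
      using n K unfolding L_def by (subst ln_mult) (auto simp: ln_realpow)
    also have "\<dots> \<le> 5 * K + 5 + real (k + 7) * L" using ln_le_minus_one[of "5 * K + 6"] K by simp
    finally have "2 * ln (real q) + 1 \<le> (10 * K + 11) * 1 + 2 * (real (k + 7) * L)" by (simp add: algebra_simps)
    also have "\<dots> \<le> (10 * K + 11) * (2 * L) + 2 * (real (k + 7) * L)"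
      using L K by (intro add_right_mono mult_left_mono) auto
    finally show ?thesis by (simp add: algebra_simps)
  qed
  have "real B \<le> ((15 * K + 6) * (real n * R * L)) * ((20 * K + 2 * real k + 36) * L)"
    using M_le lnq K L R by (intro order_trans[OF B(2)] mult_mono) (auto simp: q_def)
  also have "\<dots> = 32 * real (c + 4) * (15 * K + 6) * (20 * K + 2 * real k + 36)
    * real n * sqrt \<beta> * (ln (real n)) ^ 3 / \<epsilon>"
    unfolding R_def l_def L_def by (simp add: power3_eq_cube)
  finally have bound: "real B \<le> \<dots>" .
  \<comment> \<open>The two trivial cuts have value 0 and are answered exactly; every other cut has
    rounded value at least 1 and falls under the tail bound.\<close>
  define dec where "dec = (\<lambda>S F. if S = {} \<or> S = {..<n} then 0 else \<epsilon> / 4 * decode n R h S F)"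
  have messages_exist: "\<exists>p. set_pmf p \<subseteq> messages n h M Q \<and> (\<forall>S\<subseteq>{..<n}. measure_pmf.prob p
      {m. (1 - \<epsilon>) * cutw w S ({..<n} - S) \<le> dec S m \<and> dec S m \<le> (1 + \<epsilon>) * cutw w S ({..<n} - S)}
      \<ge> 1 - 1 / real n ^ c)" if w: "balanced n \<beta> w \<and> weights_ok n k w" for w
  proof -
    define a where "a = scaled (\<epsilon> / 4) w"
    have w': "balanced n \<beta> w" "weights_ok n k w" "0 < \<epsilon> / 4" "\<epsilon> / 4 \<le> 1 / 4" using w \<epsilon> by auto
    have N1: "1 \<le> N" unfolding N_def using n by (intro one_le_power) auto
    have "real n ^ k / (\<epsilon> / 4) \<le> real N"
    proof -
      \<comment> \<open>Both \<open>1 / \<epsilon>\<close> and 4 are at most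
        \<open>n\<^sup>2\<close>, which explains the exponent \<open>k + 4\<close> in
        \<open>N\<close>.\<close>
      have "1 / \<epsilon> \<le> (real n)\<^sup>2" using large \<epsilon> n by (simp add: field_simps)
      moreover have "2 ^ 2 \<le> (real n)\<^sup>2" using n by (intro power_mono) auto
      ultimately have "4 * (1 / \<epsilon>) \<le> (real n)\<^sup>2 * (real n)\<^sup>2" using \<epsilon> by (intro mult_mono) auto
      then have "real n ^ k * (4 * (1 / \<epsilon>)) \<le> real n ^ k * ((real n)\<^sup>2 * (real n)\<^sup>2)"
        by (intro mult_left_mono) auto
      then show ?thesis unfolding N_def by (simp add: power_add eval_nat_numeral mult_ac)
    qed
    then have aN: "a u v \<le> N" for u v
      unfolding a_def using w' by (intro scaled_le[of n k]) auto
    have diag: "a u u = 0" for u unfolding a_def scaled_def by simp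
    have dcut1: "1 \<le> dcut n a S" if "S \<noteq> {}" "S \<subset> {..<n}" for S
      unfolding a_def by (rule dcut_scaled_ge_1[OF w'(1,2,3) that])
    have conn: "1 \<le> ucut n a S ({..<n} - S)" if "S \<noteq> {}" "S \<subset> {..<n}" for S
    proof -
      have "0 \<le> dcut n a ({..<n} - S)" unfolding dcut_def by (intro sum_nonneg) auto
      then show ?thesis using dcut1[OF that] unfolding ucut_eq_dcut by simp
    qed
    obtain p where p: "set_pmf p \<subseteq> messages n h M (n * N)"
      and tail: "\<And>S b x. b > 0 \<Longrightarrow> 2 * ucut n a S ({..<n} - S) / R\<^sup>2 \<le> b \<Longrightarrow> 2 * dcut n a S / R \<le> b
       \<Longrightarrow> 6 * ucut n a S ({..<n} - S) / R\<^sup>2 * dcut n a S \<le> b\<^sup>2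
       \<Longrightarrow> measure_pmf.prob p {F. x \<le> \<bar>decode n R h S F - dcut n a S\<bar>}
           \<le> exp (- (4 * real n * R * real h)) + 2 * exp (1 - x / b)"
      using ex_random_message_of_connected[where a = a, OF n R diag aN N1 conn h_large X_M[unfolded X_def]] by blast
    have "1 - 1 / real n ^ c \<le> measure_pmf.prob p
      {m. (1 - \<epsilon>) * cutw w S ({..<n} - S) \<le> dec S m \<and> dec S m \<le> (1 + \<epsilon>) * cutw w S ({..<n} - S)}"
      if S: "S \<subseteq> {..<n}" for S
    proof (cases "S = {} \<or> S = {..<n}")
      case True
      then have "cutw w S ({..<n} - S) = 0" unfolding cutw_def by auto
      then show ?thesis using True unfolding dec_def by simp
    next
      case False
      then have S': "S \<noteq> {}" "S \<subset> {..<n}" using S by auto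
      define D where "D = dcut n a S"
      define U where "U = ucut n a S ({..<n} - S)"
      \<comment> \<open>This \<open>b\<close> dominates both single-sample bounds and the square
        root of the variance: \<open>U / R\<^sup>2\<close> is at most
        \<open>4 * D * (\<epsilon> / l)\<^sup>2\<close>, so the variance is at most 24, against 64
        in \<open>b\<^sup>2\<close>, times \<open>(\<epsilon> * D / l)\<^sup>2\<close>.\<close>
      define b where "b = 8 * \<epsilon> * D / l"
      define x where "x = \<epsilon> / 4 * D"
      have D: "1 \<le> D" unfolding D_def by (rule dcut1[OF S'])
      have U: "U \<le> 4 * \<beta> * D" unfolding U_def D_def a_def by (rule scaled_balanced[OF w' S'])
      have e2: "\<epsilon> * \<epsilon> \<le> \<epsilon>" using \<epsilon> by (simp add: mult_left_le)
      have UR: "U / R\<^sup>2 \<le> 4 * D * (\<epsilon> * \<epsilon>) / (l * l)"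
      proof -
        have R2: "R\<^sup>2 = \<beta> * (l * l) / (\<epsilon> * \<epsilon>)"
          unfolding R_def power2_eq_square using sb(2) by (simp add: mult_ac)
        have "U / R\<^sup>2 \<le> 4 * \<beta> * D / R\<^sup>2" using U by (intro divide_right_mono) auto
        also have "\<dots> = 4 * D * (\<epsilon> * \<epsilon>) / (l * l)" unfolding R2 using \<beta> by simp
        finally show ?thesis .
      qed
      have b0: "0 < b" unfolding b_def using D l1 \<epsilon> by simp
      have b1: "2 * U / R\<^sup>2 \<le> b"
      proof -
        have "2 * U / R\<^sup>2 \<le> 2 * (4 * D * (\<epsilon> * \<epsilon>) / (l * l))" using UR by simp
        also have "\<dots> \<le> 2 * (4 * D * \<epsilon> / l)"
        proof (intro mult_left_mono frac_le)
          show "l \<le> l * l" using l1 by simp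
        qed (use D e2 \<epsilon> l1 in auto)
        finally show ?thesis unfolding b_def by (simp add: mult_ac)
      qed
      have b2: "2 * D / R \<le> b"
      proof -
        have "l / \<epsilon> \<le> R" unfolding R_def using sb(1) l1 \<epsilon> by (intro divide_right_mono) auto
        then have "2 * D / R \<le> 2 * D / (l / \<epsilon>)" using D l1 \<epsilon> R by (intro divide_left_mono) auto
        also have "\<dots> \<le> b" unfolding b_def using D l1 \<epsilon> by (simp add: field_simps)
        finally show ?thesis .
      qed
      have b3: "6 * U / R\<^sup>2 * D \<le> b\<^sup>2"
      proof -
        have "6 * U / R\<^sup>2 * D \<le> 6 * (4 * D * (\<epsilon> * \<epsilon>) / (l * l)) * D"
          using UR D by (intro mult_right_mono) auto
        also have "\<dots> = 24 * ((\<epsilon> * D / l) * (\<epsilon> * D / l))" by simp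
        also have "\<dots> \<le> 64 * ((\<epsilon> * D / l) * (\<epsilon> * D / l))" by (intro mult_right_mono) auto
        finally show ?thesis unfolding b_def power2_eq_square by (simp add: mult_ac)
      qed
      have xb: "x / b = real (c + 4) * L"
        unfolding x_def b_def using D \<epsilon> l1 by (simp add: l_def)
      have small: "exp (- (real (c + 4) * L)) \<le> (1 / 16) * (1 / real n ^ c)"
      proof -
        have "exp (real (c + 4) * L) = exp L ^ (c + 4)" by (rule exp_of_nat_mult)
        also have "\<dots> = real n ^ c * real n ^ 4" unfolding L_def using n by (simp add: power_add)
        finally have e: "exp (real (c + 4) * L) = real n ^ c * real n ^ 4" .
        have "exp (- (real (c + 4) * L)) = 1 / real n ^ 4 * (1 / real n ^ c)"
          unfolding exp_minus e by (simp add: inverse_eq_divide)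
        moreover have "2 ^ 4 \<le> real n ^ 4" using n by (intro power_mono) auto
        then have "1 / real n ^ 4 \<le> 1 / 16" using n by (intro divide_left_mono) auto
        ultimately show ?thesis by (simp only:) (intro mult_right_mono, auto)
      qed
      have "measure_pmf.prob p {F. x \<le> \<bar>decode n R h S F - D\<bar>}
         \<le> exp (- (4 * real n * R * real h)) + 2 * exp (1 - x / b)"
        unfolding D_def by (rule tail) (use b0 b1 b2 b3 in \<open>simp_all add: D_def U_def\<close>)
      also have "\<dots> \<le> exp (- (real (c + 4) * L)) + 2 * (3 * exp (- (real (c + 4) * L)))"
      proof (intro add_mono mult_left_mono)
        have "real (c + 4) * L \<le> l" unfolding l_def using L by simp
        also have "l * 1 \<le> R * (4 * real n * real h)"
        proof (intro mult_mono l_R)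
          have "1 * 1 \<le> (4 * real n) * real h" using n h1 by (intro mult_mono) auto
          then show "1 \<le> 4 * real n * real h" by simp
        qed (use R in auto)
        finally show "exp (- (4 * real n * R * real h)) \<le> exp (- (real (c + 4) * L))" by (simp add: mult_ac)
        have "exp (1 - x / b) = exp 1 * exp (- (real (c + 4) * L))" unfolding xb by (simp flip: exp_add)
        also have "\<dots> \<le> 3 * exp (- (real (c + 4) * L))" using exp_le by (intro mult_right_mono) auto
        finally show "exp (1 - x / b) \<le> 3 * exp (- (real (c + 4) * L))" .
      qed simp
      \<comment> \<open>The failure bound is 1 + 2 * 3 = 7 copies of a term that is at most a
        sixteenth of \<open>1 / n ^ c\<close>, because \<open>n\<close> is at least 2.\<close>
      also have "\<dots> \<le> 7 * ((1 / 16) * (1 / real n ^ c))" using small by simp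
      also have "\<dots> \<le> 1 / real n ^ c"
      proof -
        have "0 \<le> 1 / real n ^ c" by simp
        then show ?thesis by linarith
      qed
      finally have bad: "measure_pmf.prob p {F. x \<le> \<bar>decode n R h S F - D\<bar>} \<le> 1 / real n ^ c" .
      have "1 - 1 / real n ^ c \<le> 1 - measure_pmf.prob p {F. x \<le> \<bar>decode n R h S F - D\<bar>}"
        using bad by simp
      also have "\<dots> = measure_pmf.prob p (- {F. x \<le> \<bar>decode n R h S F - D\<bar>})"
        using measure_pmf.prob_compl[of "{F. x \<le> \<bar>decode n R h S F - D\<bar>}" p] by (simp add: Compl_eq_Diff_UNIV)
      also have "\<dots> \<le> measure_pmf.prob p
          {m. (1 - \<epsilon>) * cutw w S ({..<n} - S) \<le> dec S m \<and> dec S m \<le> (1 + \<epsilon>) * cutw w S ({..<n} - S)}"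
      proof (rule measure_pmf.finite_measure_mono)
        show "- {F. x \<le> \<bar>decode n R h S F - D\<bar>} \<subseteq> {m. (1 - \<epsilon>) * cutw w S ({..<n} - S) \<le> dec S m
            \<and> dec S m \<le> (1 + \<epsilon>) * cutw w S ({..<n} - S)}"
        proof
          fix F assume "F \<in> - {F. x \<le> \<bar>decode n R h S F - D\<bar>}"
          then have le: "\<bar>decode n R h S F - D\<bar> \<le> \<epsilon> / 4 * D" unfolding x_def by simp
          have "dec S F = \<epsilon> / 4 * decode n R h S F" using False unfolding dec_def by simp
          then show "F \<in> {m. (1 - \<epsilon>) * cutw w S ({..<n} - S) \<le> dec S m
            \<and> dec S m \<le> (1 + \<epsilon>) * cutw w S ({..<n} - S)}"
            using relative_error[OF \<epsilon> cutw_nonneg[OF w'(2) S] scaled_dcut[OF w'(2,3) S], folded a_def D_def, OF le]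
            by (simp only: mem_Collect_eq)
        qed
      qed simp
      finally show ?thesis .
    qed
    then show ?thesis using p unfolding Q_def by blast
  qed
  have card: "card (messages n h M Q) \<le> 2 ^ B"
    using card_messages_le(2)[of n h M Q] B(1) unfolding q_def by (rule order_trans)
  show ?thesis
    unfolding has_sketch_def
    by (rule sketch_of_messages[where valid = "\<lambda>w. balanced n \<beta> w \<and> weights_ok n k w" and
          good = "\<lambda>w S x. (1 - \<epsilon>) * cutw w S ({..<n} - S) \<le> x \<and> x \<le> (1 + \<epsilon>) * cutw w S ({..<n} - S)",
        OF card_messages_le(1) card bound messages_exist])
qed

lemma has_sketch_mono:
  assumes "has_sketch n k c \<beta> \<epsilon> b" "b \<le> b'"
  shows "has_sketch n k c \<beta> \<epsilon> b'"
proof -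
  obtain g f where gf: "\<forall>w. balanced n \<beta> w \<and> weights_ok n k w \<longrightarrow>
         (\<forall>x \<in> set_pmf (g w). real (length (x :: bool list)) \<le> b) \<and>
         (\<forall>S \<subseteq> {..<n}. measure_pmf.prob (g w)
              {x. (1 - \<epsilon>) * cutw w S ({..<n} - S) \<le> f S x \<and>
                  f S x \<le> (1 + \<epsilon>) * cutw w S ({..<n} - S)}
            \<ge> 1 - 1 / real n ^ c)"
    using assms(1) unfolding has_sketch_def by (elim exE)
  show ?thesis
    unfolding has_sketch_def
  proof (intro exI[of _ g] exI[of _ f] allI impI conjI ballI)
    fix w x assume "balanced n \<beta> w \<and> weights_ok n k w" "x \<in> set_pmf (g w)"
    then have "real (length x) \<le> b" using gf by blast
    then show "real (length x) \<le> b'" using assms(2) by (rule order_trans)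
  qed (use gf in blast)
qed

theorem theorem7:
  fixes k c :: nat
  shows "\<exists>C::real. \<forall>(n::nat) (\<beta>::real) (\<epsilon>::real).
     n \<ge> 2 \<and> \<beta> \<ge> 1 \<and> 0 < \<epsilon> \<and> \<epsilon> < 1 \<longrightarrow>
     (\<exists>(g :: (nat \<Rightarrow> nat \<Rightarrow> real) \<Rightarrow> bool list pmf) (f :: nat set \<Rightarrow> bool list \<Rightarrow> real).
       \<forall>w. balanced n \<beta> w \<and> weights_ok n k w \<longrightarrow>
         (\<forall>x \<in> set_pmf (g w).
            real (length x) \<le> C * real n * sqrt \<beta> * (ln (real n)) ^ 3 / \<epsilon>) \<and>
         (\<forall>S \<subseteq> {..<n}.
            measure_pmf.prob (g w)
              {x. (1 - \<epsilon>) * cutw w S ({..<n} - S) \<le> f S x \<and>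
                  f S x \<le> (1 + \<epsilon>) * cutw w S ({..<n} - S)}
            \<ge> 1 - 1 / real n ^ c))"
proof -
  define K where "K = real (4 * (k + 8))"
  define C1 where "C1 = real (456 + 8 * k)"
  define C2 where "C2 = 32 * real (c + 4) * (15 * K + 6) * (20 * K + 2 * real k + 36)"
  have "has_sketch n k c \<beta> \<epsilon> (max C1 C2 * real n * sqrt \<beta> * (ln (real n)) ^ 3 / \<epsilon>)"
    if "n \<ge> 2" "\<beta> \<ge> 1" "0 < \<epsilon>" "\<epsilon> < 1" for n :: nat and \<beta> \<epsilon> :: real
  proof -
    have mono: "C * real n * sqrt \<beta> * (ln (real n)) ^ 3 / \<epsilon> \<le> max C1 C2 * real n * sqrt \<beta> * (ln (real n)) ^ 3 / \<epsilon>"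
      if "C \<le> max C1 C2" for C
      using that \<open>n \<ge> 2\<close> \<open>\<beta> \<ge> 1\<close> \<open>0 < \<epsilon>\<close> by (intro divide_right_mono mult_right_mono) auto
    show ?thesis
    \<comment> \<open>From this threshold on, 1 / \<epsilon> is polynomial in \<open>n\<close> and
      sampling is used; below it the whole rounded graph fits into the budget.\<close>
    proof (cases "\<epsilon> < 1 / (real n)\<^sup>2")
      case True
      have "has_sketch n k c \<beta> \<epsilon> (C1 * real n * sqrt \<beta> * (ln (real n)) ^ 3 / \<epsilon>)"
        unfolding C1_def by (rule has_sketch_small_eps[OF that True])
      then show ?thesis by (rule has_sketch_mono[OF _ mono]) simp
    next
      case False
      then have "1 / (real n)\<^sup>2 \<le> \<epsilon>" by simp
      then have "has_sketch n k c \<beta> \<epsilon> (C2 * real n * sqrt \<beta> * (ln (real n)) ^ 3 / \<epsilon>)"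
        unfolding C2_def K_def by (rule has_sketch_large_eps[OF that])
      then show ?thesis by (rule has_sketch_mono[OF _ mono]) simp
    qed
  qed
  then show ?thesis
    unfolding has_sketch_def by (intro exI[of _ "max C1 C2"] allI impI) (elim conjE)
qed

end
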